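(* Let $A\in\mathbb{R}^{m\times n}$ and let $I\subseteq[m]\times[r]$, $J\subseteq[n]\times[r]$ be such that for all $k\in\bar T$, $\mathcal{S}'_k$ is rectangular, and for all $k,l\in\bar T$ either $\mathcal{S}'_k=\mathcal{S}'_l$ or $\mathcal{S}'_k\cap\mathcal{S}'_l=\emptyset$. If a feasible point $(X,Y)$ is CEC-full-rank, then $(X,Y)$ is not a spurious local minimum of $L(X,Y)=\|A-XY^\top\|_F^2$ over the feasible set. Otherwise there is a feasible path along which $L$ is constant that joins $(X,Y)$ to some feasible $(\tilde X,\tilde Y)$ which is not a spurious local minimum.
   Context: $[p]=\{1,\dots,p\}$; $\mathrm{supp}(M)=\{(i,j):M_{i,j}\ne0\}$. Feasible: $\mathrm{supp}(X)\subseteq I$, $\mathrm{supp}(Y)\subseteq J$; a feasible path is a continuous map $[0,1]\to\mathbb{R}^{m\times r}\times\mathbb{R}^{n\times r}$ with feasible values. A spurious local minimum is a local minimizer of $L$ on the feasible set that is not a global minimizer. Rank-one supports $\mathcal{S}_k=\{i:(i,k)\in I\}\times\{j:(j,k)\in J\}$; equivalence $k\sim l$ iff $\mathcal{S}_k=\mathcal{S}_l$; for a class $P$: $\mathcal{S}_P$, $R_P=\{i:(i,k)\in I\}$, $C_P=\{j:(j,k)\in J\}$ ($k\in P$). $P$ is a CEC if $|P|\ge\min(|R_P|,|C_P|)$; $\mathcal{P}^\star$ the CECs; $T=\bigcup_{P\in\mathcal{P}^\star}P$, $\bar T=[r]\setminus T$, $\mathcal{S}_T=\bigcup_{P\in\mathcal{P}^\star}\mathcal{S}_P$.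 For $k\in\bar T$, $\mathcal{S}'_k=\mathcal{S}_k\setminus\mathcal{S}_T$, rectangular if $=R_k\times C_k$ for some $R_k\subseteq[m],C_k\subseteq[n]$. $(X,Y)$ is CEC-full-rank if for each $P\in\mathcal{P}^\star$, $X_{R_P,P}$ or $Y_{C_P,P}$ has full row rank. *)

theory Defs
  imports "HOL-Analysis.Analysis"
begin

text \<open>An $m \times r$ matrix is an element of \<open>real^'r^'m\<close> (rows indexed by \<open>'m\<close>);
  the index types \<open>'m\<close>, \<open>'n\<close>, \<open>'r\<close> play the roles of $[m]$, $[n]$, $[r]$.\<close>

definition supp :: "real^'b^'a \<Rightarrow> ('a \<times> 'b) set" where
  "supp M = {(i, j). M $ i $ j \<noteq> 0}"

definition feasible ::
  "('m \<times> 'r) set \<Rightarrow> ('n \<times> 'r) set \<Rightarrow> ((real^'r^'m) \<times> (real^'r^'n)) set" where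
  "feasible I J = {(X, Y). supp X \<subseteq> I \<and> supp Y \<subseteq> J}"

text \<open>The norm of \<open>real^'n^'m\<close> is the Frobenius norm; see \<open>norm_matrix_power2\<close> below.\<close>

definition loss :: "real^'n^'m \<Rightarrow> (real^'r^'m) \<times> (real^'r^'n) \<Rightarrow> real" where
  "loss A = (\<lambda>(X, Y). (norm (A - X ** transpose Y))\<^sup>2)"

lemma norm_matrix_power2:
  fixes M :: "real^'n^'m"
  shows "(norm M)\<^sup>2 = (\<Sum>i\<in>UNIV. \<Sum>j\<in>UNIV. (M $ i $ j)\<^sup>2)"
  by (simp add: norm_vec_def L2_set_def sum_nonneg)

definition local_minimizer_on :: "('a::metric_space \<Rightarrow> real) \<Rightarrow> 'a set \<Rightarrow> 'a \<Rightarrow> bool" where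
  "local_minimizer_on f S z \<longleftrightarrow>
     z \<in> S \<and> (\<exists>e>0. \<forall>w\<in>S. dist w z < e \<longrightarrow> f z \<le> f w)"

definition global_minimizer_on :: "('a \<Rightarrow> real) \<Rightarrow> 'a set \<Rightarrow> 'a \<Rightarrow> bool" where
  "global_minimizer_on f S z \<longleftrightarrow> z \<in> S \<and> (\<forall>w\<in>S. f z \<le> f w)"

definition spurious_local_min_on :: "('a::metric_space \<Rightarrow> real) \<Rightarrow> 'a set \<Rightarrow> 'a \<Rightarrow> bool" where
  "spurious_local_min_on f S z \<longleftrightarrow> local_minimizer_on f S z \<and> \<not> global_minimizer_on f S z"

definition feasible_path ::
  "('m \<times> 'r) set \<Rightarrow> ('n \<times> 'r) set \<Rightarrow> (real \<Rightarrow> (real^'r^'m) \<times> (real^'r^'n)) \<Rightarrow> bool" where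
  "feasible_path I J \<gamma> \<longleftrightarrow> path \<gamma> \<and> path_image \<gamma> \<subseteq> feasible I J"

definition column_support :: "('a \<times> 'r) set \<Rightarrow> 'r \<Rightarrow> 'a set" where
  "column_support K k = {i. (i, k) \<in> K}"

definition rank_one_support ::
  "('m \<times> 'r) set \<Rightarrow> ('n \<times> 'r) set \<Rightarrow> 'r \<Rightarrow> ('m \<times> 'n) set" where
  "rank_one_support I J k = column_support I k \<times> column_support J k"

definition same_support :: "('m \<times> 'r) set \<Rightarrow> ('n \<times> 'r) set \<Rightarrow> ('r \<times> 'r) set" where
  "same_support I J = {(k, l). rank_one_support I J k = rank_one_support I J l}"

definition support_classes :: "('m \<times> 'r) set \<Rightarrow> ('n \<times> 'r) set \<Rightarrow> 'r set set" where
  "support_classes I J = UNIV // same_support I J"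

text \<open>$R_P$, $C_P$ and $\mathcal{S}_P$ are read off from one common representative $k \in P$.
  They do not depend on it, except that $R_P$ and $C_P$ may when $\mathcal{S}_P = \emptyset$;
  then $R_P = \emptyset$ or $C_P = \emptyset$ whichever $k$ is chosen, so that $P$ is always a CEC
  whose full-row-rank condition holds trivially.\<close>

definition class_rep :: "'r set \<Rightarrow> 'r" where
  "class_rep P = (SOME k. k \<in> P)"

definition class_rows :: "('m \<times> 'r) set \<Rightarrow> 'r set \<Rightarrow> 'm set" where
  "class_rows I P = column_support I (class_rep P)"

definition class_cols :: "('n \<times> 'r) set \<Rightarrow> 'r set \<Rightarrow> 'n set" where
  "class_cols J P = column_support J (class_rep P)"

definition class_support ::
  "('m \<times> 'r) set \<Rightarrow> ('n \<times> 'r) set \<Rightarrow> 'r set \<Rightarrow> ('m \<times> 'n) set" where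
  "class_support I J P = rank_one_support I J (class_rep P)"

lemma class_support_eq:
  assumes "P \<in> support_classes I J" "k \<in> P"
  shows "class_support I J P = rank_one_support I J k"
proof -
  have "class_rep P \<in> P"
    unfolding class_rep_def using assms(2) by (rule someI)
  with assms show ?thesis
    by (auto simp: support_classes_def quotient_def same_support_def class_support_def)
qed

lemma class_rows_cols_eq:
  assumes "P \<in> support_classes I J" "k \<in> P" "class_support I J P \<noteq> {}"
  shows "class_rows I P = column_support I k" "class_cols J P = column_support J k"
  using class_support_eq[OF assms(1,2)] assms(3)
  by (auto simp: class_support_def rank_one_support_def class_rows_def class_cols_def times_eq_iff)

definition CECs :: "('m::finite \<times> 'r::finite) set \<Rightarrow> ('n::finite \<times> 'r) set \<Rightarrow> 'r set set" where
  "CECs I J = {P \<in> support_classes I J. card P \<ge> min (card (class_rows I P)) (card (class_cols J P))}"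

definition CEC_indices :: "('m::finite \<times> 'r::finite) set \<Rightarrow> ('n::finite \<times> 'r) set \<Rightarrow> 'r set" where
  "CEC_indices I J = \<Union> (CECs I J)"

definition CEC_support ::
  "('m::finite \<times> 'r::finite) set \<Rightarrow> ('n::finite \<times> 'r) set \<Rightarrow> ('m \<times> 'n) set" where
  "CEC_support I J = (\<Union>P\<in>CECs I J. class_support I J P)"

text \<open>$\mathcal{S}'_k$\<close>

definition residual_support ::
  "('m::finite \<times> 'r::finite) set \<Rightarrow> ('n::finite \<times> 'r) set \<Rightarrow> 'r \<Rightarrow> ('m \<times> 'n) set" where
  "residual_support I J k = rank_one_support I J k - CEC_support I J"

definition rectangular :: "('m \<times> 'n) set \<Rightarrow> bool" where
  "rectangular S \<longleftrightarrow> (\<exists>R C. S = R \<times> C)"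

text \<open>The submatrix $M_{R,P}$ is represented by its extension by zero to the full index set,
  which has the same rank; it has \<open>card R\<close> rows.\<close>

definition submatrix_zero :: "real^'b^'a \<Rightarrow> 'a set \<Rightarrow> 'b set \<Rightarrow> real^'b^'a" where
  "submatrix_zero M R P = (\<chi> i j. if i \<in> R \<and> j \<in> P then M $ i $ j else 0)"

definition full_row_rank_on :: "real^'b^'a \<Rightarrow> 'a set \<Rightarrow> 'b set \<Rightarrow> bool" where
  "full_row_rank_on M R P \<longleftrightarrow> rank (submatrix_zero M R P) = card R"

definition CEC_full_rank ::
  "('m::finite \<times> 'r::finite) set \<Rightarrow> ('n::finite \<times> 'r) set
    \<Rightarrow> (real^'r^'m) \<times> (real^'r^'n) \<Rightarrow> bool" where
  "CEC_full_rank I J = (\<lambda>(X, Y). \<forall>P\<in>CECs I J.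
     full_row_rank_on X (class_rows I P) P \<or> full_row_rank_on Y (class_cols J P) P)"

end

(* On the CEC blocks, full row rank of one factor lets the other one correct the product linearly:
   so at a CEC-full-rank local minimizer the residual vanishes on the CEC support, and any small
   change of the remaining columns can be compensated there without affecting anything else.
   Off the CEC support the loss therefore splits into independent unconstrained low-rank
   approximation problems on disjoint rectangles, each of which has no spurious local minimum.

   For low-rank approximation with residual E = B - X Y^T: a kernel vector of X forces E = 0 by a
   third-order perturbation; otherwise a second-order perturbation shows that the singular values
   of X Y^T on the column space of X dominate those of E, and a trace comparison between the
   complements of two subspaces yields the Eckart-Young bound without a singular value
   decomposition.

   A point that is not CEC-full-rank is joined to one that is, along a path on which even X Y^T is
   constant, by raising the rank of each deficient CEC block one step at a time. *)
theory Submission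
  imports Defs
begin

section \<open>Products with a transposed factor\<close>

text \<open>The columns outside the CECs still contribute on the CEC support: only the parts of
  their rank-one supports outside it are assumed rectangular and disjoint or equal. Moving one
  residual block therefore spills into the CEC support, and the linear correction absorbs the spill,
  quadratic terms included. Local minimality has to be carried from the whole problem to a block, so
  the correction must be continuous and zero at the base point. The final comparison is entrywise:
  every feasible competitor restricts to a competitor in each block. At a local minimizer of a
  block, stationarity gives E Y = 0 and X^T E = 0, so E and X Y^T have orthogonal row spaces and
  orthogonal column spaces. A competitor has rank at most the number of columns of the block.
  Without a kernel vector the column space of X has exactly that dimension, which the trace argument
  needs; with one the dimension comparison can fail, hence the separate case. On the path side, the
  CEC inequality is what supplies kernel vectors: a block of rank below |R| <= |P| is never
  injective on its |P| columns.\<close>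

abbreviation mul_transpose :: "real^'r^'m \<Rightarrow> real^'r^'n \<Rightarrow> real^'n^'m"  (infixl "\<odot>" 70)
  where "X \<odot> Y \<equiv> X ** transpose Y"

lemma mul_transpose_nth: "(X \<odot> Y) $ i $ j = (\<Sum>k\<in>UNIV. X $ i $ k * Y $ j $ k)"
  by (simp add: matrix_matrix_mult_def transpose_def)

lemma bounded_bilinear_mul_transpose:
  "bounded_bilinear (\<lambda>(X::real^'r^'m) (Y::real^'r^'n). X \<odot> Y)"
  unfolding bilinear_conv_bounded_bilinear[symmetric] bilinear_def
  by (auto intro!: linearI
      simp: vec_eq_iff mul_transpose_nth algebra_simps sum.distrib sum_distrib_left)

lemmas mul_transpose_add_left = bounded_bilinear.add_left[OF bounded_bilinear_mul_transpose]
  and mul_transpose_add_right = bounded_bilinear.add_right[OF bounded_bilinear_mul_transpose]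
  and mul_transpose_scaleR_left = bounded_bilinear.scaleR_left[OF bounded_bilinear_mul_transpose]
  and mul_transpose_scaleR_right = bounded_bilinear.scaleR_right[OF bounded_bilinear_mul_transpose]
  and mul_transpose_zero_left = bounded_bilinear.zero_left[OF bounded_bilinear_mul_transpose]
  and mul_transpose_zero_right = bounded_bilinear.zero_right[OF bounded_bilinear_mul_transpose]
  and mul_transpose_sum_left = bounded_bilinear.sum_left[OF bounded_bilinear_mul_transpose]
  and mul_transpose_sum_right = bounded_bilinear.sum_right[OF bounded_bilinear_mul_transpose]
  and continuous_on_mul_transpose =
    bounded_bilinear.continuous_on[OF bounded_bilinear_mul_transpose]

definition outer :: "real^'m \<Rightarrow> real^'n \<Rightarrow> real^'n^'m" where
  "outer u v = (\<chi> i j. u $ i * v $ j)"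

lemma outer_nth: "outer u v $ i $ j = u $ i * v $ j"
  by (simp add: outer_def)

lemma outer_scaleR_left: "outer (c *\<^sub>R u) v = c *\<^sub>R outer u v"
  and outer_scaleR_right: "outer u (c *\<^sub>R v) = c *\<^sub>R outer u v"
  and outer_add_left: "outer (u + u') v = outer u v + outer u' v"
  and outer_add_right: "outer u (v + v') = outer u v + outer u v'"
  and outer_zero_left: "outer 0 v = 0"
  and outer_zero_right: "outer u 0 = 0"
  by (simp_all add: vec_eq_iff outer_nth algebra_simps)

lemma outer_matrix_vector_mult: "outer u v *v w = (v \<bullet> w) *\<^sub>R u"
  by (simp add: vec_eq_iff matrix_vector_mult_def outer_nth inner_vec_def sum_distrib_left
      algebra_simps)

lemma mul_transpose_outer_right: "X \<odot> outer d w = outer (X *v w) d"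
  by (simp add: vec_eq_iff mul_transpose_nth outer_nth matrix_vector_mult_def sum_distrib_left
      algebra_simps)

lemma mul_transpose_outer_left: "outer u w \<odot> Y = outer u (Y *v w)"
  by (simp add: vec_eq_iff mul_transpose_nth outer_nth matrix_vector_mult_def sum_distrib_left
      algebra_simps)

lemma inner_outer: "E \<bullet> outer u v = u \<bullet> (E *v v)"
  by (simp add: inner_vec_def outer_nth matrix_vector_mult_def sum_distrib_left algebra_simps)

text \<open>Adjointness of right multiplication by \<open>Y\<close> and by its transpose. With
  \<open>E\<close> the residual, \<open>E ** Y\<close> is -1/2 times the gradient of the loss in
  \<open>X\<close>.\<close>

lemma inner_mul_transpose: "E \<bullet> (X \<odot> Y) = (E ** Y) \<bullet> X"
proof -
  have "E \<bullet> (X \<odot> Y) = (\<Sum>i\<in>UNIV. \<Sum>j\<in>UNIV. \<Sum>k\<in>UNIV. E $ i $ j * Y $ j $ k * X $ i $ k)"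
    by (simp add: inner_vec_def mul_transpose_nth sum_distrib_left algebra_simps)
  also have "\<dots> = (\<Sum>i\<in>UNIV. \<Sum>k\<in>UNIV. \<Sum>j\<in>UNIV. E $ i $ j * Y $ j $ k * X $ i $ k)"
    by (intro sum.cong refl) (rule sum.swap)
  also have "\<dots> = (E ** Y) \<bullet> X"
    by (simp add: inner_vec_def matrix_matrix_mult_def sum_distrib_right)
  finally show ?thesis .
qed

lemma transpose_mul_transpose: "transpose (X \<odot> Y) = Y \<odot> X"
  by (simp add: matrix_transpose_mul)

lemma norm_transpose: "norm (transpose (M::real^'n^'m)) = norm M"
proof -
  have "(norm (transpose M))\<^sup>2 = (norm M)\<^sup>2"
    unfolding norm_matrix_power2 by (subst sum.swap) (simp add: transpose_def)
  then show ?thesis by simp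
qed

section \<open>Loss, feasibility and the exchange of the two factors\<close>

lemma loss_eq: "loss A (X, Y) = (norm (A - X \<odot> Y))\<^sup>2"
  by (simp add: loss_def)

lemma loss_swap: "loss (transpose A) (Y, X) = loss A (X, Y)"
proof -
  have "transpose A - Y \<odot> X = transpose (A - X \<odot> Y)"
    by (simp add: vec_eq_iff transpose_def matrix_matrix_mult_def mult.commute[of "Y $ _ $ _"])
  then show ?thesis by (simp add: loss_eq norm_transpose)
qed

lemma feasible_iff:
  "(X, Y) \<in> feasible I J \<longleftrightarrow>
    (\<forall>i k. (i, k) \<notin> I \<longrightarrow> X $ i $ k = 0) \<and> (\<forall>j k. (j, k) \<notin> J \<longrightarrow> Y $ j $ k = 0)"
  by (auto simp: feasible_def supp_def)

lemma feasible_swap: "(Y, X) \<in> feasible J I \<longleftrightarrow> (X, Y) \<in> feasible I J"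
  by (auto simp: feasible_iff)

lemma local_minimizer_on_swap:
  assumes "local_minimizer_on (loss A) (feasible I J) (X, Y)"
  shows "local_minimizer_on (loss (transpose A)) (feasible J I) (Y, X)"
proof -
  from assms obtain e where e: "e > 0" "(X, Y) \<in> feasible I J"
    "\<And>w. w \<in> feasible I J \<Longrightarrow> dist w (X, Y) < e \<Longrightarrow> loss A (X, Y) \<le> loss A w"
    by (auto simp: local_minimizer_on_def)
  have "loss (transpose A) (Y, X) \<le> loss (transpose A) (Y', X')"
    if "(Y', X') \<in> feasible J I" "dist (Y', X') (Y, X) < e" for X' Y'
  proof -
    have "dist (X', Y') (X, Y) = dist (Y', X') (Y, X)"
      by (simp only: dist_Pair_Pair add.commute)
    with e(3)[of "(X', Y')"] that feasible_swap[of Y' X' J I] show ?thesis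
      by (simp add: loss_swap)
  qed
  then show ?thesis
    unfolding local_minimizer_on_def
    using e(1) by (intro conjI exI[of _ e]) (auto simp: feasible_swap[of Y X J I] e(2))
qed

section \<open>Local minimality tested along one-parameter curves\<close>

lemma local_minimizer_on_curve:
  fixes \<gamma> :: "real \<Rightarrow> 'a::metric_space"
  assumes "local_minimizer_on f S z" "isCont \<gamma> 0" "\<gamma> 0 = z" "\<And>t. \<gamma> t \<in> S"
  shows "\<forall>\<^sub>F t in at 0. f z \<le> f (\<gamma> t)"
proof -
  from assms(1) obtain e where e: "e > 0" "\<And>w. w \<in> S \<Longrightarrow> dist w z < e \<Longrightarrow> f z \<le> f w"
    by (auto simp: local_minimizer_on_def)
  from assms(2,3) have "(\<gamma> \<longlongrightarrow> z) (at 0)" by (simp add: isCont_def)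
  then have "\<forall>\<^sub>F t in at 0. dist (\<gamma> t) z < e" using e(1) by (rule tendstoD)
  then show ?thesis by eventually_elim (use e(2) assms(4) in blast)
qed

text \<open>Only small positive \<open>t\<close> are looked at, where \<open>t ^ n\<close> can be
  divided out whatever the parity of \<open>n\<close>; the limit then gives the sign of
  \<open>p 0\<close>. Applied with order 1 (stationarity), 2 (singular values) and 3 (kernel
  vectors).\<close>

lemma leading_coeff_nonneg:
  fixes p :: "real \<Rightarrow> real"
  assumes ev: "\<forall>\<^sub>F t in at 0. 0 \<le> t ^ n * p t" and p: "isCont p 0"
  shows "0 \<le> p 0"
proof (rule tendsto_lowerbound)
  show "(p \<longlongrightarrow> p 0) (at_right 0)"
    using p by (simp add: isCont_def filterlim_at_split)
  have "\<forall>\<^sub>F t in at_right 0. 0 \<le> t ^ n * p t"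
    using ev by (simp add: eventually_at_split)
  moreover have "\<forall>\<^sub>F t in at_right 0. (0::real) < t"
    by (rule eventually_at_right_less)
  ultimately show "\<forall>\<^sub>F t in at_right 0. 0 \<le> p t"
  proof eventually_elim
    case (elim t)
    then show ?case by (meson mult_pos_neg not_le zero_less_power)
  qed
qed simp

lemma norm_diff_power2:
  fixes a b :: "'a::real_inner"
  shows "(norm (a - b))\<^sup>2 = (norm a)\<^sup>2 - 2 * (a \<bullet> b) + (norm b)\<^sup>2"
  by (simp add: power2_norm_eq_inner inner_diff_left inner_diff_right inner_commute)

section \<open>Low-rank approximation\<close>

lemma linear_vector_matrix_mult: "linear (\<lambda>z::real^'m. z v* (M::real^'n^'m))"
  using matrix_vector_mul_linear[of "transpose M"] by simp

text \<open>\<open>K\<close> is an orthonormal basis of the orthogonal complement of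
  \<open>S\<close>, so the last clause is Parseval's identity for
  \<open>B \<union> K\<close>.\<close>

lemma orthonormal_basis_complement:
  fixes S :: "'a::euclidean_space set"
  assumes "subspace S"
  obtains B K where "finite B" "finite K" "card B = dim S" "span B = S"
    "pairwise orthogonal B" "\<And>b. b \<in> B \<Longrightarrow> norm b = 1"
    "\<And>b. b \<in> K \<Longrightarrow> norm b = 1"
    "\<And>b x. b \<in> K \<Longrightarrow> x \<in> S \<Longrightarrow> b \<bullet> x = 0"
    "\<And>v. (norm v)\<^sup>2 = (\<Sum>b\<in>B. (v \<bullet> b)\<^sup>2) + (\<Sum>b\<in>K. (v \<bullet> b)\<^sup>2)"
proof -
  obtain B where B: "B \<subseteq> S" "pairwise orthogonal B" "\<And>x. x \<in> B \<Longrightarrow> norm x = 1"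
    "independent B" "card B = dim S" "span B = S"
    using orthonormal_basis_subspace[OF assms] by metis
  obtain K where K: "K \<subseteq> orthogonal_comp S" "pairwise orthogonal K"
    "\<And>x. x \<in> K \<Longrightarrow> norm x = 1" "independent K" "span K = orthogonal_comp S"
    using orthonormal_basis_subspace[OF subspace_orthogonal_comp[of S]] by metis
  have fin: "finite B" "finite K"
    using B(4) K(4) by (auto intro: independent_imp_finite)
  have orth: "b \<bullet> x = 0" if "b \<in> K" "x \<in> S" for b x
    using K(1) that by (auto simp: orthogonal_comp_def orthogonal_def inner_commute)
  have disj: "B \<inter> K = {}"
  proof -
    have "b \<bullet> b = 0" if "b \<in> B" "b \<in> K" for b
      using orth that B(1) by blast
    then show ?thesis using B(3) by fastforce
  qed
  have pw: "pairwise orthogonal (B \<union> K)"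
  proof -
    have "orthogonal b k" "orthogonal k b" if "b \<in> B" "k \<in> K" for b k
      using orth[OF that(2), of b] that B(1) by (auto simp: orthogonal_def inner_commute)
    then show ?thesis using B(2) K(2) unfolding pairwise_def by blast
  qed
  have span: "span (B \<union> K) = UNIV"
  proof -
    have "v \<in> span (B \<union> K)" for v
    proof -
      have "v \<in> S + orthogonal_comp S"
        using subspace_sum_orthogonal_comp[OF assms] by simp
      then obtain x y where "v = x + y" "x \<in> span B" "y \<in> span K"
        using B(6) K(5) by (auto elim!: set_plus_elim)
      then show ?thesis
        by (meson Un_upper1 Un_upper2 span_add span_mono subsetD)
    qed
    then show ?thesis by blast
  qed
  have "(norm v)\<^sup>2 = (\<Sum>b\<in>B. (v \<bullet> b)\<^sup>2) + (\<Sum>b\<in>K. (v \<bullet> b)\<^sup>2)" for v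
  proof -
    have "(\<Sum>b\<in>B \<union> K. (v \<bullet> b) *\<^sub>R b) = v"
      using pw B(3) K(3) fin by (intro orthonormal_basis_expand) (auto simp: span)
    then have "v \<bullet> v = (\<Sum>b\<in>B \<union> K. (v \<bullet> b)\<^sup>2)"
      by (metis (mono_tags, lifting) inner_scaleR_right inner_sum_right power2_eq_square sum.cong)
    then show ?thesis
      using fin disj by (simp add: power2_norm_eq_inner sum.union_disjoint)
  qed
  with that[of B K] B K fin orth show ?thesis by metis
qed

text \<open>Parseval column by column: the entries of \<open>b v* M\<close> are the coordinates of
  the columns of \<open>M\<close> along \<open>b\<close>.\<close>

lemma norm_matrix_orthonormal:
  fixes M :: "real^'n^'m"
  assumes "\<And>v::real^'m. (norm v)\<^sup>2 = (\<Sum>b\<in>B. (v \<bullet> b)\<^sup>2) + (\<Sum>b\<in>K. (v \<bullet> b)\<^sup>2)"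
  shows "(norm M)\<^sup>2 = (\<Sum>b\<in>B. (norm (b v* M))\<^sup>2) + (\<Sum>b\<in>K. (norm (b v* M))\<^sup>2)"
proof -
  have nth: "(b v* M) $ j = column j M \<bullet> b" for b j
    by (simp add: vector_matrix_mult_def column_def inner_vec_def mult.commute)
  have row: "(norm (b v* M))\<^sup>2 = (\<Sum>j\<in>UNIV. (column j M \<bullet> b)\<^sup>2)" for b
    by (simp add: norm_vec_def L2_set_def sum_nonneg nth)
  have "(norm M)\<^sup>2 = (\<Sum>j\<in>UNIV. (norm (column j M))\<^sup>2)"
    unfolding norm_matrix_power2
    by (subst sum.swap) (simp add: norm_vec_def L2_set_def sum_nonneg column_def)
  also have "\<dots> = (\<Sum>j\<in>UNIV. \<Sum>b\<in>B. (column j M \<bullet> b)\<^sup>2) + (\<Sum>j\<in>UNIV. \<Sum>b\<in>K. (column j M \<bullet> b)\<^sup>2)"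
    by (simp add: assms sum.distrib)
  also have "\<dots> = (\<Sum>b\<in>B. (norm (b v* M))\<^sup>2) + (\<Sum>b\<in>K. (norm (b v* M))\<^sup>2)"
    unfolding row by (simp add: sum.swap[of _ UNIV])
  finally show ?thesis .
qed

text \<open>\<open>U\<close> stands for the current product, with columns in \<open>S\<close>,
  \<open>E\<close> for its residual and \<open>Z\<close> for a competitor with columns in
  \<open>T\<close>. Vectors orthogonal to \<open>T\<close> do not see \<open>Z\<close>, so summing
  over a basis \<open>K\<close> of that complement bounds the right side below by the
  \<open>K\<close>-parts of \<open>U\<close> and \<open>E\<close>, which add up by
  \<open>orth\<close>. It remains to pay for the part of \<open>E\<close> along \<open>T\<close>
  with the part of \<open>U\<close> along \<open>K\<close>; the level \<mu> separates the
  two.\<close>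

lemma low_rank_bound:
  fixes U E Z :: "real^'n^'m"
  assumes S: "subspace S" and T: "subspace T" and dim: "dim T \<le> dim S"
    and U: "\<And>b. (\<And>x. x \<in> S \<Longrightarrow> b \<bullet> x = 0) \<Longrightarrow> b v* U = 0"
    and Z: "\<And>b. (\<And>x. x \<in> T \<Longrightarrow> b \<bullet> x = 0) \<Longrightarrow> b v* Z = 0"
    and E: "\<And>x. x \<in> S \<Longrightarrow> x v* E = 0"
    and orth: "\<And>a b. (a v* U) \<bullet> (b v* E) = 0"
    and lam: "0 \<le> \<mu>"
    and US: "\<And>x. x \<in> S \<Longrightarrow> \<mu> * (norm x)\<^sup>2 \<le> (norm (x v* U))\<^sup>2"
    and EN: "\<And>z. (norm (z v* E))\<^sup>2 \<le> \<mu> * (norm z)\<^sup>2"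
  shows "(norm E)\<^sup>2 \<le> (norm (U + E - Z))\<^sup>2"
proof -
  obtain B B' where B: "finite B" "finite B'" "card B = dim S" "span B = S"
    "pairwise orthogonal B" "\<And>b. b \<in> B \<Longrightarrow> norm b = 1"
    "\<And>b x. b \<in> B' \<Longrightarrow> x \<in> S \<Longrightarrow> b \<bullet> x = 0"
    using orthonormal_basis_complement[OF S] by metis
  obtain Q K where Q: "finite Q" "finite K" "card Q = dim T" "span Q = T"
    "\<And>b. b \<in> Q \<Longrightarrow> norm b = 1"
    "\<And>b x. b \<in> K \<Longrightarrow> x \<in> T \<Longrightarrow> b \<bullet> x = 0"
    and split: "\<And>v. (norm v)\<^sup>2 = (\<Sum>b\<in>Q. (v \<bullet> b)\<^sup>2) + (\<Sum>b\<in>K. (v \<bullet> b)\<^sup>2)"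
    using orthonormal_basis_complement[OF T] by metis
  \<comment> \<open>Orthogonal projection onto \<open>S\<close>. Below, \<open>U\<close> sees only
    \<open>p v\<close> and \<open>E\<close> only \<open>v - p v\<close>.\<close>
  define p where "p v = (\<Sum>b\<in>B. (v \<bullet> b) *\<^sub>R b)" for v
  have B_inner: "b \<bullet> c = (if b = c then 1 else 0)" if "b \<in> B" "c \<in> B" for b c
    using B(5,6) that by (auto simp: pairwise_def orthogonal_def norm_eq_1)
  have pS: "p v \<in> S" for v
    unfolding p_def using B(4) by (metis (no_types, lifting) span_base span_scale span_sum)
  have p_inner: "p v \<bullet> b = v \<bullet> b" if "b \<in> B" for v b
    using that B(1) by (simp add: p_def inner_sum_left B_inner if_distrib cong: if_cong)
  have perp: "(v - p v) \<bullet> x = 0" if "x \<in> S" for v x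
  proof -
    have "orthogonal (v - p v) b" if "b \<in> B" for b
      using p_inner[OF that] by (simp add: orthogonal_def inner_diff_left)
    then show ?thesis
      using orthogonal_to_span[of x B "v - p v"] that B(4) by (simp add: orthogonal_def)
  qed
  have np: "(norm (p v))\<^sup>2 = (\<Sum>b\<in>B. (v \<bullet> b)\<^sup>2)" for v
  proof -
    have "p v \<bullet> p v = (\<Sum>b\<in>B. (v \<bullet> b) * (p v \<bullet> b))"
      by (subst (2) p_def) (simp add: inner_sum_right)
    then show ?thesis
      by (simp add: power2_norm_eq_inner p_inner power2_eq_square[of "_ \<bullet> _"])
  qed
  have ndiff: "(norm (v - p v))\<^sup>2 = (norm v)\<^sup>2 - (norm (p v))\<^sup>2" for v
    using perp[OF pS, of v v] by (simp add: power2_norm_eq_inner inner_diff_left inner_diff_right inner_commute)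
  have Up: "v v* U = p v v* U" for v
    using U[of "v - p v"] perp[of _ v] linear_diff[OF linear_vector_matrix_mult, of v "p v" U] by simp
  have Ep: "v v* E = (v - p v) v* E" for v
    using E[OF pS] linear_diff[OF linear_vector_matrix_mult, of v "p v" E] by simp
  \<comment> \<open>The trace of the projection \<open>p\<close>, evaluated in the orthonormal basis
    \<open>Q \<union> K\<close>.\<close>
  have "(\<Sum>b\<in>Q. (norm (p b))\<^sup>2) + (\<Sum>b\<in>K. (norm (p b))\<^sup>2)
      = (\<Sum>c\<in>B. (\<Sum>b\<in>Q. (c \<bullet> b)\<^sup>2) + (\<Sum>b\<in>K. (c \<bullet> b)\<^sup>2))"
    unfolding np sum.distrib by (simp add: sum.swap[of _ B] inner_commute)
  also have "\<dots> = dim S"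
    using split B(3,6) by (simp flip: split)
  finally have tr: "(\<Sum>b\<in>Q. (norm (p b))\<^sup>2) + (\<Sum>b\<in>K. (norm (p b))\<^sup>2) = dim S" .
  \<comment> \<open>By the trace identity and \<open>dim T \<le> dim S\<close>, the mass of
    \<open>Q\<close> outside \<open>S\<close> is at most the mass of \<open>K\<close> inside
    \<open>S\<close>. The former is weighted by at most \<mu> in \<open>E\<close>, the latter by at
    least \<mu> in \<open>U\<close>.\<close>
  have "(\<Sum>b\<in>Q. (norm (b v* E))\<^sup>2) \<le> (\<Sum>b\<in>Q. \<mu> * (norm (b - p b))\<^sup>2)"
    using EN by (intro sum_mono) (subst Ep, blast)
  also have "\<dots> = \<mu> * (dim T - (\<Sum>b\<in>Q. (norm (p b))\<^sup>2))"
    using Q(3,5) by (simp add: ndiff sum_subtractf flip: sum_distrib_left)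
  also have "\<dots> \<le> \<mu> * (\<Sum>b\<in>K. (norm (p b))\<^sup>2)"
    using tr dim lam by (intro mult_left_mono) auto
  also have "\<dots> \<le> (\<Sum>b\<in>K. (norm (b v* U))\<^sup>2)"
    unfolding sum_distrib_left using US[OF pS] Up by (intro sum_mono) metis
  finally have key: "(\<Sum>b\<in>Q. (norm (b v* E))\<^sup>2) \<le> (\<Sum>b\<in>K. (norm (b v* U))\<^sup>2)" .
  have "(norm E)\<^sup>2 = (\<Sum>b\<in>Q. (norm (b v* E))\<^sup>2) + (\<Sum>b\<in>K. (norm (b v* E))\<^sup>2)"
    by (rule norm_matrix_orthonormal[OF split])
  also have "\<dots> \<le> (\<Sum>b\<in>K. (norm (b v* U))\<^sup>2) + (\<Sum>b\<in>K. (norm (b v* E))\<^sup>2)"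
    using key by simp
  also have "\<dots> = (\<Sum>b\<in>K. (norm (b v* (U + E - Z)))\<^sup>2)"
    unfolding sum.distrib[symmetric]
  proof (rule sum.cong[OF refl])
    fix b assume b: "b \<in> K"
    have "b v* (U + E - Z) = b v* U + b v* E - b v* Z"
      by (simp add: vec_eq_iff vector_matrix_mult_def algebra_simps sum.distrib sum_subtractf)
    also have "b v* Z = 0"
      using Z Q(6)[OF b] by blast
    finally show "(norm (b v* U))\<^sup>2 + (norm (b v* E))\<^sup>2 = (norm (b v* (U + E - Z)))\<^sup>2"
      using orth[of b b] by (simp add: power2_norm_eq_inner inner_add_left inner_add_right inner_commute)
  qed
  also have "\<dots> \<le> (norm (U + E - Z))\<^sup>2"
    unfolding norm_matrix_orthonormal[OF split, of "U + E - Z"] by (simp add: sum_nonneg)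
  finally show ?thesis .
qed

lemma vector_mul_transpose: "a v* (X \<odot> Y) = Y *v (a v* X)"
  by (simp flip: vector_matrix_mul_assoc)

lemma isCont_curve:
  fixes U V :: "'a::real_normed_vector" and U' V' :: "'b::real_normed_vector"
  shows "isCont (\<lambda>t::real. (U + t ^ m *\<^sub>R V, U' + t ^ n *\<^sub>R V')) 0"
  by (intro continuous_intros)

section \<open>Necessary conditions at a local minimizer on a rectangle\<close>

lemma residual_outside_rectangle:
  assumes "(X, Y) \<in> feasible (R \<times> P) (C \<times> P)"
    and "\<And>i j. i \<notin> R \<or> j \<notin> C \<Longrightarrow> B $ i $ j = 0"
    and "i \<notin> R \<or> j \<notin> C"
  shows "(B - X \<odot> Y) $ i $ j = 0"
  using assms by (auto simp: mul_transpose_nth feasible_iff intro!: sum.neutral)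

text \<open>Steepest descent in \<open>X\<close> alone: \<open>U = E ** Y\<close> is itself a
  feasible direction, since \<open>E\<close> vanishes in rows outside \<open>R\<close> and
  \<open>Y\<close> in columns outside \<open>P\<close>, and the slope along it is -2 times its
  squared norm.\<close>

lemma local_minimizer_residual_mult:
  fixes B :: "real^'n^'m" and X :: "real^'r^'m" and Y :: "real^'r^'n"
  assumes min: "local_minimizer_on (loss B) (feasible (R \<times> P) (C \<times> P)) (X, Y)"
    and B: "\<And>i j. i \<notin> R \<or> j \<notin> C \<Longrightarrow> B $ i $ j = 0"
  shows "(B - X \<odot> Y) ** Y = 0"
proof -
  have feas: "(X, Y) \<in> feasible (R \<times> P) (C \<times> P)"
    using min by (simp add: local_minimizer_on_def)
  define E where "E = B - X \<odot> Y"
  define U where "U = E ** Y"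
  have E0: "E $ i $ j = 0" if "i \<notin> R \<or> j \<notin> C" for i j
    unfolding E_def using residual_outside_rectangle[OF feas B] that by blast
  have U: "U $ i $ k = 0" if "i \<notin> R \<or> k \<notin> P" for i k
    using that E0 feas by (auto simp: U_def matrix_matrix_mult_def feasible_iff intro!: sum.neutral)
  define \<gamma> where "\<gamma> t = (X + t ^ 1 *\<^sub>R U, Y + t ^ 1 *\<^sub>R 0)" for t :: real
  have "\<forall>\<^sub>F t in at 0. loss B (X, Y) \<le> loss B (\<gamma> t)"
  proof (rule local_minimizer_on_curve[OF min])
    show "isCont \<gamma> 0" unfolding \<gamma>_def by (rule isCont_curve)
    show "\<gamma> 0 = (X, Y)" by (simp add: \<gamma>_def)
    show "\<gamma> t \<in> feasible (R \<times> P) (C \<times> P)" for t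
      using feas U by (auto simp: \<gamma>_def feasible_iff)
  qed
  moreover have "loss B (\<gamma> t) = loss B (X, Y) + t ^ 1 * (- 2 * (U \<bullet> U) + t * (norm (U \<odot> Y))\<^sup>2)" for t
  proof -
    have "B - (X + t *\<^sub>R U) \<odot> Y = E - t *\<^sub>R (U \<odot> Y)"
      by (simp add: E_def mul_transpose_add_left mul_transpose_scaleR_left)
    then show ?thesis
      by (simp add: \<gamma>_def loss_eq norm_diff_power2 inner_mul_transpose power_mult_distrib
          flip: E_def U_def) (simp add: algebra_simps power2_eq_square)
  qed
  ultimately have "\<forall>\<^sub>F t in at 0. 0 \<le> t ^ 1 * (- 2 * (U \<bullet> U) + t * (norm (U \<odot> Y))\<^sup>2)"
    by simp
  then have "0 \<le> - 2 * (U \<bullet> U) + 0 * (norm (U \<odot> Y))\<^sup>2"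
    by (rule leading_coeff_nonneg) (intro continuous_intros)
  then have "U = 0"
    using inner_gt_zero_iff[of U] by linarith
  then show ?thesis by (simp add: U_def E_def)
qed

text \<open>Stationarity in \<open>Y\<close>, obtained by transposing the previous lemma: X^T E = 0,
  tested on the column space of \<open>X\<close>.\<close>

lemma local_minimizer_vector_mult_residual:
  fixes B :: "real^'n^'m" and X :: "real^'r^'m" and Y :: "real^'r^'n"
  assumes min: "local_minimizer_on (loss B) (feasible (R \<times> P) (C \<times> P)) (X, Y)"
    and B: "\<And>i j. i \<notin> R \<or> j \<notin> C \<Longrightarrow> B $ i $ j = 0"
  shows "(X *v q) v* (B - X \<odot> Y) = 0"
proof -
  have "(transpose B - Y \<odot> X) ** X = 0"
    by (rule local_minimizer_residual_mult[OF local_minimizer_on_swap[OF min]])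
      (simp add: transpose_def B disj_commute)
  moreover have "transpose B - Y \<odot> X = transpose (B - X \<odot> Y)"
    by (simp add: vec_eq_iff transpose_def matrix_matrix_mult_def mult.commute[of "Y $ _ $ _"])
  ultimately have "transpose (B - X \<odot> Y) *v (X *v q) = 0"
    by (simp only: matrix_vector_mul_assoc) simp
  then show ?thesis by simp
qed

text \<open>Since \<open>X *v w = 0\<close>, adding a multiple of \<open>outer v w\<close> to
  \<open>Y\<close> leaves the product as it is, but makes room for a change of \<open>X\<close>
  along \<open>w\<close> to add \<open>outer u v\<close>. As \<open>u\<close> and \<open>v\<close>
  are arbitrary on the rectangle, any nonzero entry of the residual could be reduced.\<close>

lemma local_minimizer_rank_deficient:
  fixes B :: "real^'n^'m" and X :: "real^'r^'m" and Y :: "real^'r^'n"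
  assumes min: "local_minimizer_on (loss B) (feasible (R \<times> P) (C \<times> P)) (X, Y)"
    and B: "\<And>i j. i \<notin> R \<or> j \<notin> C \<Longrightarrow> B $ i $ j = 0"
    and w: "w \<noteq> 0" "\<And>k. k \<notin> P \<Longrightarrow> w $ k = 0" "X *v w = 0"
  shows "B - X \<odot> Y = 0"
proof -
  have feas: "(X, Y) \<in> feasible (R \<times> P) (C \<times> P)"
    using min by (simp add: local_minimizer_on_def)
  define E where "E = B - X \<odot> Y"
  have EY: "E *v (Y *v z) = 0" for z
    using local_minimizer_residual_mult[OF min B]
    by (simp add: matrix_vector_mul_assoc E_def)
  have "E $ i $ j = 0" for i j
  proof (cases "i \<in> R \<and> j \<in> C")
    case False
    then show ?thesis
      unfolding E_def using residual_outside_rectangle[OF feas B] by blast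
  next
    case True
    define u where "u = (axis i 1 :: real^'m)"
    \<comment> \<open>The factor \<open>E $ i $ j\<close> orients the perturbation towards the
      residual: \<open>u \<bullet> (E *v v)\<close> becomes a square.\<close>
    define v where "v = E $ i $ j *\<^sub>R (axis j 1 :: real^'n)"
    have u: "u $ i' = 0" if "i' \<notin> R" for i' using True that by (auto simp: u_def axis_def)
    have v: "v $ j' = 0" if "j' \<notin> C" for j' using True that by (auto simp: v_def axis_def)
    have uEv: "u \<bullet> (E *v v) = (E $ i $ j)\<^sup>2"
      by (simp add: u_def v_def inner_axis' matrix_vector_mult_scaleR matrix_vector_mult_basis
          column_def power2_eq_square)
    define D where "D t = outer u (Y *v w + (t * (w \<bullet> w)) *\<^sub>R v)" for t
    \<comment> \<open>The speeds 2 and 1 differ on purpose. The order-2 term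
      \<open>outer u (Y *v w)\<close> is orthogonal to \<open>E\<close> because E Y = 0, and its
      square enters only at order 4, so the gain from the cross term at order 3 decides.\<close>
    define \<gamma> where "\<gamma> t = (X + t ^ 2 *\<^sub>R outer u w, Y + t ^ 1 *\<^sub>R outer v w)" for t :: real
    have "\<forall>\<^sub>F t in at 0. loss B (X, Y) \<le> loss B (\<gamma> t)"
    proof (rule local_minimizer_on_curve[OF min])
      show "isCont \<gamma> 0" unfolding \<gamma>_def by (rule isCont_curve)
      show "\<gamma> 0 = (X, Y)" by (simp add: \<gamma>_def)
      show "\<gamma> t \<in> feasible (R \<times> P) (C \<times> P)" for t
        using feas u v w(2) by (auto simp: \<gamma>_def feasible_iff outer_nth)
    qed
    moreover have "loss B (\<gamma> t) = loss B (X, Y)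
        + t ^ 3 * (- 2 * (w \<bullet> w) * (E $ i $ j)\<^sup>2 + t * (norm (D t))\<^sup>2)" for t
    proof -
      have "B - (X + t\<^sup>2 *\<^sub>R outer u w) \<odot> (Y + t *\<^sub>R outer v w) = E - t\<^sup>2 *\<^sub>R D t"
        by (simp add: E_def D_def mul_transpose_add_left mul_transpose_add_right
            mul_transpose_scaleR_left mul_transpose_scaleR_right mul_transpose_outer_left
            mul_transpose_outer_right outer_matrix_vector_mult w(3) outer_zero_left
            outer_add_right outer_scaleR_right matrix_vector_mult_add_rdistrib outer_add_left
            outer_scaleR_left algebra_simps flip: scaleR_matrix_vector_assoc)
      moreover have "E \<bullet> D t = t * (w \<bullet> w) * (E $ i $ j)\<^sup>2"
        by (simp add: D_def inner_outer matrix_vector_right_distrib EY matrix_vector_mult_scaleR uEv)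
      ultimately show ?thesis
        by (simp add: \<gamma>_def loss_eq norm_diff_power2 power_mult_distrib flip: E_def)
          (simp add: algebra_simps power2_eq_square power3_eq_cube power4_eq_xxxx)
    qed
    ultimately have "\<forall>\<^sub>F t in at 0. 0 \<le> t ^ 3 * (- 2 * (w \<bullet> w) * (E $ i $ j)\<^sup>2 + t * (norm (D t))\<^sup>2)"
      by simp
    then have "0 \<le> - 2 * (w \<bullet> w) * (E $ i $ j)\<^sup>2 + 0 * (norm (D 0))\<^sup>2"
    proof (rule leading_coeff_nonneg)
      have "D = (\<lambda>t. outer u (Y *v w) + t *\<^sub>R outer u ((w \<bullet> w) *\<^sub>R v))"
        by (simp add: D_def fun_eq_iff outer_add_right outer_scaleR_right)
      then show "isCont (\<lambda>t. - 2 * (w \<bullet> w) * (E $ i $ j)\<^sup>2 + t * (norm (D t))\<^sup>2) 0"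
        by (simp only:) (intro continuous_intros)
    qed
    moreover have "w \<bullet> w > 0" using w(1) by simp
    ultimately show ?thesis
      by (simp add: mult_le_0_iff)
  qed
  then show ?thesis by (simp add: vec_eq_iff E_def)
qed

text \<open>If \<open>E\<close> were stronger on \<open>z\<close> than the product is on the unit
  vector \<open>x = X *v w\<close>, tilting \<open>x\<close> towards \<open>z\<close> would pay. The
  curve replaces X by (I + t z x^T) X and adds t e w^T to Y, where e = E^T z. Stationarity removes
  the first-order effect; at second order a gain of 2 |e|^2 faces a cost of |z|^2 |a|^2 +
  |e|^2.\<close>

lemma local_minimizer_singular_gap:
  fixes B :: "real^'n^'m" and X :: "real^'r^'m" and Y :: "real^'r^'n"
  assumes min: "local_minimizer_on (loss B) (feasible (R \<times> P) (C \<times> P)) (X, Y)"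
    and B: "\<And>i j. i \<notin> R \<or> j \<notin> C \<Longrightarrow> B $ i $ j = 0"
    and w: "\<And>k. k \<notin> P \<Longrightarrow> w $ k = 0" "norm (X *v w) = 1"
  shows "norm (z v* (B - X \<odot> Y)) \<le> norm z * norm ((X *v w) v* (X \<odot> Y))"
proof -
  have feas: "(X, Y) \<in> feasible (R \<times> P) (C \<times> P)"
    using min by (simp add: local_minimizer_on_def)
  define E where "E = B - X \<odot> Y"
  have E0: "E $ i $ j = 0" if "i \<notin> R \<or> j \<notin> C" for i j
    unfolding E_def using residual_outside_rectangle[OF feas B] that by blast
  have EY: "E *v (Y *v z) = 0" for z
    using local_minimizer_residual_mult[OF min B]
    by (simp add: matrix_vector_mul_assoc E_def)
  have EX: "(X *v q) v* E = 0" for q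
    unfolding E_def by (rule local_minimizer_vector_mult_residual[OF min B])
  define x where "x = X *v w"
  define a where "a = x v* (X \<odot> Y)"
  have xx: "x \<bullet> x = 1" using w(2) by (simp add: x_def norm_eq_1)
  have gap: "norm (z v* E) \<le> norm z * norm a" if z: "\<And>i. i \<notin> R \<Longrightarrow> z $ i = 0" for z
  proof -
    define e where "e = z v* E"
    define D where "D t = outer z a + outer x e + t *\<^sub>R outer z e" for t
    have ae: "E *v a = 0" by (simp only: a_def vector_mul_transpose EY)
    have "x v* E = 0" by (simp add: x_def EX)
    then have xEe: "x \<bullet> (E *v e) = 0"
      by (metis dot_lmul_matrix inner_zero_left)
    have zEe: "z \<bullet> (E *v e) = e \<bullet> e"
      by (simp add: e_def flip: dot_lmul_matrix)
    have ea: "e \<bullet> a = 0"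
      by (simp add: e_def dot_lmul_matrix ae)
    have e: "e $ j = 0" if "j \<notin> C" for j
      using that E0 by (simp add: e_def vector_matrix_mult_def)
    have g: "(x v* X) $ k = 0" if "k \<notin> P" for k
      using that feas by (simp add: vector_matrix_mult_def feasible_iff)
    define \<gamma> where "\<gamma> t = (X + t ^ 1 *\<^sub>R outer z (x v* X), Y + t ^ 1 *\<^sub>R outer e w)" for t :: real
    have "\<forall>\<^sub>F t in at 0. loss B (X, Y) \<le> loss B (\<gamma> t)"
    proof (rule local_minimizer_on_curve[OF min])
      show "isCont \<gamma> 0" unfolding \<gamma>_def by (rule isCont_curve)
      show "\<gamma> 0 = (X, Y)" by (simp add: \<gamma>_def)
      show "\<gamma> t \<in> feasible (R \<times> P) (C \<times> P)" for t
        using feas z e g w(1) by (auto simp: \<gamma>_def feasible_iff outer_nth)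
    qed
    moreover have "loss B (\<gamma> t) = loss B (X, Y) + t ^ 2 * (- 2 * (e \<bullet> e) + (norm (D t))\<^sup>2)" for t
    proof -
      \<comment> \<open>The normalisation of \<open>w\<close> makes the coefficient of
        \<open>outer z e\<close> in the product exactly \<open>t ^ 2\<close>.\<close>
      have "(x v* X) \<bullet> w = 1"
        by (simp add: dot_lmul_matrix xx flip: x_def)
      then have "B - (X + t *\<^sub>R outer z (x v* X)) \<odot> (Y + t *\<^sub>R outer e w) = E - t *\<^sub>R D t"
        by (simp add: E_def D_def mul_transpose_add_left mul_transpose_add_right
            mul_transpose_scaleR_left mul_transpose_scaleR_right mul_transpose_outer_left
            mul_transpose_outer_right outer_matrix_vector_mult outer_scaleR_left a_def
            vector_mul_transpose matrix_vector_mult_add_rdistrib outer_add_left algebra_simps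
            flip: x_def scaleR_matrix_vector_assoc)
      moreover have "E \<bullet> D t = t * (e \<bullet> e)"
        by (simp add: D_def inner_add_right inner_outer ae xEe zEe)
      ultimately show ?thesis
        by (simp add: \<gamma>_def loss_eq norm_diff_power2 power_mult_distrib flip: E_def)
          (simp add: algebra_simps power2_eq_square)
    qed
    ultimately have "\<forall>\<^sub>F t in at 0. 0 \<le> t ^ 2 * (- 2 * (e \<bullet> e) + (norm (D t))\<^sup>2)"
      by simp
    then have "0 \<le> - 2 * (e \<bullet> e) + (norm (D 0))\<^sup>2"
    proof (rule leading_coeff_nonneg)
      show "isCont (\<lambda>t. - 2 * (e \<bullet> e) + (norm (D t))\<^sup>2) 0"
        unfolding D_def by (intro continuous_intros)
    qed
    also have "(norm (D 0))\<^sup>2 = (z \<bullet> z) * (a \<bullet> a) + e \<bullet> e"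
      by (simp add: D_def power2_norm_eq_inner inner_add_left inner_add_right inner_outer
          outer_matrix_vector_mult matrix_vector_mult_add_rdistrib xx ea inner_commute[of a e]
          mult.commute)
    finally have "(norm e)\<^sup>2 \<le> (norm z * norm a)\<^sup>2"
      by (simp add: power_mult_distrib power2_norm_eq_inner)
    then show ?thesis
      by (simp add: e_def power2_le_iff_abs_le)
  qed
  \<comment> \<open>Feasibility of the curve needs \<open>z\<close> supported on \<open>R\<close>.
    Since \<open>E\<close> vanishes in the other rows, cutting \<open>z\<close> down keeps
    \<open>z v* E\<close> and does not lengthen \<open>z\<close>.\<close>
  define z' where "z' = (\<chi> i. if i \<in> R then z $ i else 0)"
  have "z v* E = z' v* E"
    using E0 by (auto simp: vec_eq_iff vector_matrix_mult_def z'_def intro!: sum.cong)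
  moreover have "norm z' \<le> norm z"
    by (rule norm_le_componentwise_cart) (simp add: z'_def)
  ultimately have "norm (z v* E) \<le> norm z * norm a"
    using gap[of z'] by (simp add: z'_def) (meson mult_right_mono norm_ge_zero order_trans)
  then show ?thesis by (simp add: E_def a_def x_def)
qed

section \<open>Local minimizers of the block problem are global\<close>

lemma dim_vectors_supported_on: "dim {x::real^'n. \<forall>i. i \<notin> D \<longrightarrow> x $ i = 0} = card D"
  using dim_substandard_cart[where 'a = real and 'n = 'n and d = D] by (simp add: dim_vec_eq)

lemma subspace_vectors_supported_on: "subspace {x::real^'n. \<forall>i. i \<notin> D \<longrightarrow> x $ i = 0}"
  by (simp add: subspace_def)

lemma low_rank_no_spurious_local_minimizer:
  fixes B :: "real^'n^'m" and X :: "real^'r^'m" and Y :: "real^'r^'n"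
  assumes min: "local_minimizer_on (loss B) (feasible (R \<times> P) (C \<times> P)) (X, Y)"
    and B: "\<And>i j. i \<notin> R \<or> j \<notin> C \<Longrightarrow> B $ i $ j = 0"
  shows "global_minimizer_on (loss B) (feasible (R \<times> P) (C \<times> P)) (X, Y)"
proof -
  have feas: "(X, Y) \<in> feasible (R \<times> P) (C \<times> P)"
    using min by (simp add: local_minimizer_on_def)
  \<comment> \<open>Feasible factors are zero in columns outside \<open>P\<close>, so
    \<open>W\<close> is their effective domain, and kernels and ranks are taken relative to
    it.\<close>
  define W where "W = {w::real^'r. \<forall>k. k \<notin> P \<longrightarrow> w $ k = 0}"
  have W: "subspace W" "dim W = card P"
    unfolding W_def by (rule subspace_vectors_supported_on dim_vectors_supported_on)+
  have range_W: "\<exists>w'\<in>W. M *v w' = M *v w" if "\<And>i k. k \<notin> P \<Longrightarrow> M $ i $ k = 0"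
    for M :: "real^'r^'m" and w
    by (rule bexI[of _ "\<chi> k. if k \<in> P then w $ k else 0"])
      (auto simp: W_def vec_eq_iff matrix_vector_mult_def that intro!: sum.cong)
  have lin: "linear ((*v) M)" for M :: "real^'r^'m"
    by (rule matrix_vector_mul_linear)
  define E where "E = B - X \<odot> Y"
  have "(norm E)\<^sup>2 \<le> (norm (B - X' \<odot> Y'))\<^sup>2"
    if feas': "(X', Y') \<in> feasible (R \<times> P) (C \<times> P)" for X' Y'
  proof (cases "\<exists>w\<in>W. w \<noteq> 0 \<and> X *v w = 0")
    case True
    then obtain w where w: "w \<noteq> 0" "\<And>k. k \<notin> P \<Longrightarrow> w $ k = 0" "X *v w = 0"
      by (auto simp: W_def)
    have "E = 0"
      unfolding E_def by (rule local_minimizer_rank_deficient[OF min]) (use B w in auto)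
    then show ?thesis by simp
  next
    case False
    have EY: "E *v (Y *v z) = 0" for z
      using local_minimizer_residual_mult[OF min B]
      by (simp add: matrix_vector_mul_assoc E_def)
    have EX: "(X *v q) v* E = 0" for q
      unfolding E_def by (rule local_minimizer_vector_mult_residual[OF min B])
    define S where "S = (*v) X ` W"
    define T where "T = (*v) X' ` W"
    have XS: "X *v w \<in> S" for w
    proof -
      have "\<exists>w'\<in>W. X *v w' = X *v w"
        by (rule range_W) (use feas in \<open>auto simp: feasible_iff\<close>)
      then show ?thesis unfolding S_def by (metis imageI)
    qed
    have XT: "X' *v w \<in> T" for w
    proof -
      have "\<exists>w'\<in>W. X' *v w' = X' *v w"
        by (rule range_W) (use feas' in \<open>auto simp: feasible_iff\<close>)
      then show ?thesis unfolding T_def by (metis imageI)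
    qed
    have inj: "inj_on ((*v) X) W"
      unfolding linear_inj_on_iff_eq_0[OF lin W(1)] using False by blast
    have dimS: "dim S = card P"
      unfolding S_def using dim_image_eq[OF lin, of X W] inj W by (simp add: span_eq_iff[THEN iffD2])
    have gap: "norm (z v* E) \<le> norm z * norm (x v* (X \<odot> Y))" if "x \<in> S" "norm x = 1" for x z
      using that local_minimizer_singular_gap[OF min B] by (auto simp: S_def W_def E_def)
    \<comment> \<open>The largest singular value of the residual. By \<open>gap\<close> it is at
      most the norm of \<open>x v* (X \<odot> Y)\<close> for every unit \<open>x\<close> in
      \<open>S\<close>, so its square is a separating level.\<close>
    define \<sigma> where "\<sigma> = onorm (\<lambda>z. z v* E)"
    have bl: "bounded_linear (\<lambda>z. z v* E)"
      by (simp add: linear_conv_bounded_linear[symmetric] linear_vector_matrix_mult)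
    have "(norm E)\<^sup>2 \<le> (norm (X \<odot> Y + E - X' \<odot> Y'))\<^sup>2"
    proof (rule low_rank_bound[where S = S and T = T and \<mu> = "\<sigma>\<^sup>2"])
      show "subspace S" "subspace T"
        unfolding S_def T_def using W(1) lin by (auto intro: linear_subspace_image)
      show "dim T \<le> dim S"
        unfolding dimS T_def using dim_image_le[OF lin] W(2) by metis
      show "b v* (X \<odot> Y) = 0" if "\<And>x. x \<in> S \<Longrightarrow> b \<bullet> x = 0" for b
      proof -
        have "(b v* X) \<bullet> w = 0" for w
          using that[OF XS] by (simp add: dot_lmul_matrix)
        then have "b v* X = 0" by (metis inner_eq_zero_iff)
        then show ?thesis by (simp only: vector_mul_transpose) simp
      qed
      show "b v* (X' \<odot> Y') = 0" if "\<And>x. x \<in> T \<Longrightarrow> b \<bullet> x = 0" for b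
      proof -
        have "(b v* X') \<bullet> w = 0" for w
          using that[OF XT] by (simp add: dot_lmul_matrix)
        then have "b v* X' = 0" by (metis inner_eq_zero_iff)
        then show ?thesis by (simp only: vector_mul_transpose) simp
      qed
      show "x v* E = 0" if "x \<in> S" for x using that EX by (auto simp: S_def)
      show "(a v* (X \<odot> Y)) \<bullet> (b v* E) = 0" for a b
        by (simp only: vector_mul_transpose inner_commute[of _ "b v* E"] dot_lmul_matrix EY) simp
      show "0 \<le> \<sigma>\<^sup>2" by simp
      show "\<sigma>\<^sup>2 * (norm x)\<^sup>2 \<le> (norm (x v* (X \<odot> Y)))\<^sup>2" if x: "x \<in> S" for x
      proof (cases "x = 0")
        case False
        define y where "y = x /\<^sub>R norm x"
        have "y \<in> S"
          unfolding y_def using x W(1) lin S_def by (metis linear_subspace_image subspace_scale)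
        then have "\<sigma> \<le> norm (y v* (X \<odot> Y))"
          unfolding \<sigma>_def using gap False
          by (intro onorm_le) (simp add: y_def mult.commute)
        also have "y v* (X \<odot> Y) = (x v* (X \<odot> Y)) /\<^sub>R norm x"
          unfolding y_def by (rule linear_scale[OF linear_vector_matrix_mult])
        finally have "\<sigma> * norm x \<le> norm (x v* (X \<odot> Y))"
          using False by (simp add: field_simps)
        moreover have "0 \<le> \<sigma>" unfolding \<sigma>_def by (rule onorm_pos_le[OF bl])
        ultimately show ?thesis
          by (metis mult_nonneg_nonneg norm_ge_zero power_mono power_mult_distrib)
      qed simp
      show "(norm (z v* E))\<^sup>2 \<le> \<sigma>\<^sup>2 * (norm z)\<^sup>2" for z
        using onorm[OF bl, of z] by (metis \<sigma>_def norm_ge_zero power_mono power_mult_distrib)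
    qed
    then show ?thesis by (simp add: E_def)
  qed
  then show ?thesis
    using feas by (auto simp: global_minimizer_on_def loss_eq E_def)
qed

section \<open>Correction on the CEC support\<close>

lemma submatrix_zero_nth:
  "submatrix_zero M R P $ i $ k = (if i \<in> R \<and> k \<in> P then M $ i $ k else 0)"
  by (simp add: submatrix_zero_def)

lemma submatrix_zero_mult_vector:
  assumes "\<And>i k. k \<in> P \<Longrightarrow> i \<notin> R \<Longrightarrow> M $ i $ k = 0"
  shows "submatrix_zero M R P *v w = M *v (\<chi> k. if k \<in> P then w $ k else 0)"
  using assms
  by (auto simp: vec_eq_iff matrix_vector_mult_def submatrix_zero_nth intro!: sum.cong)

lemma range_submatrix_zero:
  "range ((*v) (submatrix_zero M R P)) \<subseteq> {x. \<forall>i. i \<notin> R \<longrightarrow> x $ i = 0}"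
  by (auto simp: matrix_vector_mult_def submatrix_zero_nth)

text \<open>The range of the zero-extended block lies in the coordinate subspace of \<open>R\<close>
  and has the same dimension, so it contains all unit vectors of \<open>R\<close>; a preimage can be
  cut down to \<open>P\<close>.\<close>

lemma full_row_rank_on_axis:
  fixes M :: "real^'b^'a"
  assumes rank: "full_row_rank_on M R P"
    and M: "\<And>i k. k \<in> P \<Longrightarrow> i \<notin> R \<Longrightarrow> M $ i $ k = 0" and i: "i \<in> R"
  obtains w where "\<And>k. k \<notin> P \<Longrightarrow> w $ k = 0" "M *v w = axis i 1"
proof -
  have "range ((*v) (submatrix_zero M R P)) = {x. \<forall>i. i \<notin> R \<longrightarrow> x $ i = 0}"
  proof (rule subspace_dim_equal)
    show "subspace (range ((*v) (submatrix_zero M R P)))"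
      by (intro linear_subspace_image matrix_vector_mul_linear subspace_UNIV)
    show "dim (range ((*v) (submatrix_zero M R P))) \<ge> dim {x::real^'a. \<forall>i. i \<notin> R \<longrightarrow> x $ i = 0}"
      using rank by (simp add: full_row_rank_on_def rank_dim_range dim_vectors_supported_on)
  qed (rule subspace_vectors_supported_on range_submatrix_zero)+
  then have "axis i 1 \<in> range ((*v) (submatrix_zero M R P))"
    using i by (auto simp: axis_def)
  then obtain w where "axis i 1 = submatrix_zero M R P *v w" by blast
  then show thesis
    using that[of "\<chi> k. if k \<in> P then w $ k else 0"] submatrix_zero_mult_vector[of P R M w] M
    by auto
qed

lemma mul_transpose_disjoint_columns:
  assumes "\<And>i k. k \<notin> T \<Longrightarrow> U $ i $ k = 0" "\<And>j k. k \<in> T \<Longrightarrow> V $ j $ k = 0"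
  shows "U \<odot> V = 0"
proof -
  have "U $ i $ k * V $ j $ k = 0" for i j k
    using assms(1)[of k i] assms(2)[of k j] by (cases "k \<in> T") auto
  then show ?thesis by (auto simp: vec_eq_iff mul_transpose_nth intro!: sum.neutral)
qed

lemma subspace_feasible: "subspace (feasible I J)"
  by (auto simp: subspace_def feasible_iff zero_prod_def)

lemma equiv_same_support: "equiv UNIV (same_support I J)"
  by (auto simp: equiv_def refl_on_def sym_def trans_def same_support_def)

lemma support_classes_disjoint:
  assumes "P \<in> support_classes I J" "Q \<in> support_classes I J" "k \<in> P" "k \<in> Q"
  shows "P = Q"
  using quotient_disj[OF equiv_same_support] assms unfolding support_classes_def by blast

lemma CEC_class: "P \<in> CECs I J \<Longrightarrow> P \<in> support_classes I J"
  by (simp add: CECs_def)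

lemma rank_one_support_subset_CEC_support:
  assumes "k \<in> CEC_indices I J"
  shows "rank_one_support I J k \<subseteq> CEC_support I J"
  using assms class_support_eq[OF CEC_class]
  by (fastforce simp: CEC_indices_def CEC_support_def)

text \<open>The columns in \<open>TY\<close> change only in \<open>X\<close> and those in \<open>TX\<close> only in \<open>Y\<close>;
  since \<open>TX \<inter> TY = {}\<close>, the change of the product is linear in the correction.\<close>

lemma CEC_correction_unit:
  fixes X :: "real^'r^'m" and Y :: "real^'r^'n"
  assumes feas: "(X, Y) \<in> feasible I J" and full: "CEC_full_rank I J (X, Y)"
    and ij: "(i, j) \<in> CEC_support I J"
    and TX: "TX = \<Union> {P \<in> CECs I J. full_row_rank_on X (class_rows I P) P}"
    and TY: "TY = \<Union> {P \<in> CECs I J. \<not> full_row_rank_on X (class_rows I P) P}"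
  shows "\<exists>D \<in> feasible (I \<inter> UNIV \<times> TY) (J \<inter> UNIV \<times> TX).
    fst D \<odot> Y + X \<odot> snd D = outer (axis i 1) (axis j 1)"
proof -
  obtain P where P: "P \<in> CECs I J" "(i, j) \<in> class_support I J P"
    using ij by (auto simp: CEC_support_def)
  have cols: "column_support I k = class_rows I P" "column_support J k = class_cols J P" if "k \<in> P" for k
    using class_rows_cols_eq[OF CEC_class[OF P(1)] that] P(2) by auto
  have i: "i \<in> class_rows I P" and j: "j \<in> class_cols J P"
    using P(2) by (auto simp: class_support_def rank_one_support_def class_rows_def class_cols_def)
  have ik: "(i, k) \<in> I" "(j, k) \<in> J" if "k \<in> P" for k
    using cols[OF that] i j by (auto simp: column_support_def)
  have X0: "X $ i' $ k = 0" if "k \<in> P" "i' \<notin> class_rows I P" for i' k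
    using feas cols(1)[OF that(1)] that(2) by (simp add: feasible_iff column_support_def set_eq_iff)
  have Y0: "Y $ j' $ k = 0" if "k \<in> P" "j' \<notin> class_cols J P" for j' k
    using feas cols(2)[OF that(1)] that(2) by (simp add: feasible_iff column_support_def set_eq_iff)
  show ?thesis
  proof (cases "full_row_rank_on X (class_rows I P) P")
    case True
    \<comment> \<open>Solving \<open>X *v w = axis i 1\<close> inside the class turns
      \<open>outer (axis j 1) w\<close>, added to \<open>Y\<close>, into a change of the single
      product entry at \<open>(i, j)\<close>.\<close>
    then obtain w where w: "\<And>k. k \<notin> P \<Longrightarrow> w $ k = 0" "X *v w = axis i 1"
      using full_row_rank_on_axis[OF _ X0 i] by metis
    have "(0, outer (axis j 1) w) \<in> feasible (I \<inter> UNIV \<times> TY) (J \<inter> UNIV \<times> TX)"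
      using w(1) ik P(1) True by (fastforce simp: feasible_iff outer_nth axis_def TX)
    then show ?thesis
      by (intro bexI[of _ "(0, outer (axis j 1) w)"]) (simp_all add: mul_transpose_outer_right mul_transpose_zero_left w(2))
  next
    case False
    then have "full_row_rank_on Y (class_cols J P) P"
      using full P(1) by (auto simp: CEC_full_rank_def)
    then obtain w where w: "\<And>k. k \<notin> P \<Longrightarrow> w $ k = 0" "Y *v w = axis j 1"
      using full_row_rank_on_axis[OF _ Y0 j] by metis
    have "(outer (axis i 1) w, 0) \<in> feasible (I \<inter> UNIV \<times> TY) (J \<inter> UNIV \<times> TX)"
      using w(1) ik P(1) False by (fastforce simp: feasible_iff outer_nth axis_def TY)
    then show ?thesis
      by (intro bexI[of _ "(outer (axis i 1) w, 0)"])
        (simp_all add: mul_transpose_outer_left mul_transpose_zero_right w(2))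
  qed
qed

text \<open>Superposing the unit corrections gives a linear right inverse, on the CEC support, of
  the derivative of the product at \<open>(X, Y)\<close>. Linearity supplies the continuity and the
  value \<open>K 0 = 0\<close> on which the transfer to blocks relies.\<close>

lemma CEC_correction:
  fixes X :: "real^'r^'m" and Y :: "real^'r^'n"
  assumes feas: "(X, Y) \<in> feasible I J" and full: "CEC_full_rank I J (X, Y)"
  obtains TX TY and K :: "real^'n^'m \<Rightarrow> (real^'r^'m) \<times> (real^'r^'n)"
  where "TX \<inter> TY = {}" "TX \<union> TY = CEC_indices I J" "linear K"
    "\<And>G. K G \<in> feasible (I \<inter> UNIV \<times> TY) (J \<inter> UNIV \<times> TX)"
    "\<And>G. fst (K G) \<odot> Y + X \<odot> snd (K G) =
      (\<chi> i j. if (i, j) \<in> CEC_support I J then G $ i $ j else 0)"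
proof -
  define TX where "TX = \<Union> {P \<in> CECs I J. full_row_rank_on X (class_rows I P) P}"
  define TY where "TY = \<Union> {P \<in> CECs I J. \<not> full_row_rank_on X (class_rows I P) P}"
  have "\<exists>D. \<forall>p \<in> CEC_support I J. D p \<in> feasible (I \<inter> UNIV \<times> TY) (J \<inter> UNIV \<times> TX) \<and>
      fst (D p) \<odot> Y + X \<odot> snd (D p) = outer (axis (fst p) 1) (axis (snd p) 1)"
    using CEC_correction_unit[OF feas full _ TX_def TY_def] by (intro bchoice) (auto simp: Bex_def)
  then obtain D where D: "\<And>p. p \<in> CEC_support I J \<Longrightarrow> D p \<in> feasible (I \<inter> UNIV \<times> TY) (J \<inter> UNIV \<times> TX)"
    "\<And>p. p \<in> CEC_support I J \<Longrightarrow>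
      fst (D p) \<odot> Y + X \<odot> snd (D p) = outer (axis (fst p) 1) (axis (snd p) 1)"
    by blast
  define K where "K G = (\<Sum>p\<in>CEC_support I J. G $ fst p $ snd p *\<^sub>R D p)" for G :: "real^'n^'m"
  have fin: "finite (CEC_support I J)" by simp
  show thesis
  proof
    show "TX \<inter> TY = {}"
      using support_classes_disjoint[OF CEC_class CEC_class] by (fastforce simp: TX_def TY_def)
    show "TX \<union> TY = CEC_indices I J"
      by (auto simp: TX_def TY_def CEC_indices_def)
    show "linear K"
      by (rule linearI) (simp_all add: K_def scaleR_left_distrib sum.distrib scaleR_sum_right)
    show "K G \<in> feasible (I \<inter> UNIV \<times> TY) (J \<inter> UNIV \<times> TX)" for G
      unfolding K_def using D(1) by (intro subspace_sum subspace_scale subspace_feasible)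
    show "fst (K G) \<odot> Y + X \<odot> snd (K G) =
      (\<chi> i j. if (i, j) \<in> CEC_support I J then G $ i $ j else 0)" for G
    proof -
      have "fst (K G) \<odot> Y + X \<odot> snd (K G)
          = (\<Sum>p\<in>CEC_support I J. G $ fst p $ snd p *\<^sub>R (fst (D p) \<odot> Y + X \<odot> snd (D p)))"
        by (simp add: K_def fst_sum snd_sum mul_transpose_sum_left mul_transpose_sum_right
            mul_transpose_scaleR_left mul_transpose_scaleR_right scaleR_right_distrib sum.distrib)
      also have "\<dots> = (\<Sum>p\<in>CEC_support I J. G $ fst p $ snd p *\<^sub>R outer (axis (fst p) 1) (axis (snd p) 1))"
        by (simp add: D(2))
      also have "\<dots> = (\<chi> i j. if (i, j) \<in> CEC_support I J then G $ i $ j else 0)"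
      proof -
        have "(\<Sum>p\<in>CEC_support I J. G $ fst p $ snd p * (axis (fst p) 1 $ i * axis (snd p) 1 $ j))
            = (\<Sum>p\<in>CEC_support I J. if p = (i, j) then G $ i $ j else 0)" for i j
          by (intro sum.cong) (auto simp: axis_def)
        then show ?thesis
          by (simp add: vec_eq_iff outer_nth fin)
      qed
      finally show ?thesis .
    qed
  qed
qed

text \<open>Move along the correction \<open>K E\<close>. Its two parts use disjoint columns, so the
  product moves along a straight line towards \<open>A\<close> on the CEC support and nowhere else;
  the slope of the loss is -2 times the squared norm of the residual there.\<close>

lemma CEC_residual_zero:
  fixes X :: "real^'r^'m" and Y :: "real^'r^'n"
  assumes min: "local_minimizer_on (loss A) (feasible I J) (X, Y)"
    and full: "CEC_full_rank I J (X, Y)" and ij: "(i, j) \<in> CEC_support I J"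
  shows "(A - X \<odot> Y) $ i $ j = 0"
proof -
  have feas: "(X, Y) \<in> feasible I J"
    using min by (simp add: local_minimizer_on_def)
  obtain TX TY K where TXY: "TX \<inter> TY = {}" and "TX \<union> TY = CEC_indices I J" "linear K"
    and K: "\<And>G. K G \<in> feasible (I \<inter> UNIV \<times> TY) (J \<inter> UNIV \<times> TX)"
    "\<And>G. fst (K G) \<odot> Y + X \<odot> snd (K G) =
      (\<chi> i j. if (i, j) \<in> CEC_support I J then G $ i $ j else 0)"
    by (rule CEC_correction[OF feas full]) (rule that)
  define E where "E = A - X \<odot> Y"
  define M where "M = (\<chi> i j. if (i, j) \<in> CEC_support I J then E $ i $ j else 0)"
  obtain U V where UV: "K E = (U, V)" by fastforce
  have UV_feas: "(U, V) \<in> feasible (I \<inter> UNIV \<times> TY) (J \<inter> UNIV \<times> TX)"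
    using K(1)[of E] UV by simp
  have UV0: "U \<odot> V = 0"
  proof (rule mul_transpose_disjoint_columns)
    show "U $ i $ k = 0" if "k \<notin> TY" for i k
      using UV_feas that by (simp add: feasible_iff)
    show "V $ j $ k = 0" if "k \<in> TY" for j k
    proof -
      have "k \<notin> TX" using TXY that by blast
      then show ?thesis using UV_feas by (simp add: feasible_iff)
    qed
  qed
  have eff: "U \<odot> Y + X \<odot> V = M"
    using K(2)[of E] by (simp add: UV M_def)
  have EM: "E \<bullet> M = M \<bullet> M"
    unfolding inner_vec_def by (intro sum.cong refl) (auto simp: M_def)
  define \<gamma> where "\<gamma> t = (X + t ^ 1 *\<^sub>R U, Y + t ^ 1 *\<^sub>R V)" for t :: real
  have "\<forall>\<^sub>F t in at 0. loss A (X, Y) \<le> loss A (\<gamma> t)"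
  proof (rule local_minimizer_on_curve[OF min])
    show "isCont \<gamma> 0" unfolding \<gamma>_def by (rule isCont_curve)
    show "\<gamma> 0 = (X, Y)" by (simp add: \<gamma>_def)
    show "\<gamma> t \<in> feasible I J" for t
      using feas UV_feas by (auto simp: \<gamma>_def feasible_iff)
  qed
  moreover have "loss A (\<gamma> t) = loss A (X, Y) + t ^ 1 * (- 2 * (M \<bullet> M) + t * (norm M)\<^sup>2)" for t
  proof -
    have "A - (X + t *\<^sub>R U) \<odot> (Y + t *\<^sub>R V) = E - t *\<^sub>R M"
      by (simp add: E_def mul_transpose_add_left mul_transpose_add_right mul_transpose_scaleR_left
          mul_transpose_scaleR_right UV0 scaleR_right_distrib flip: eff)
    then show ?thesis
      by (simp add: \<gamma>_def loss_eq norm_diff_power2 EM power_mult_distrib flip: E_def)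
        (simp add: algebra_simps power2_eq_square)
  qed
  ultimately have "\<forall>\<^sub>F t in at 0. 0 \<le> t ^ 1 * (- 2 * (M \<bullet> M) + t * (norm M)\<^sup>2)"
    by simp
  then have "0 \<le> - 2 * (M \<bullet> M) + 0 * (norm M)\<^sup>2"
    by (rule leading_coeff_nonneg) (intro continuous_intros)
  then have "M = 0"
    using inner_gt_zero_iff[of M] by linarith
  then have "M $ i $ j = 0" by simp
  then show ?thesis using ij by (simp add: M_def E_def)
qed

text \<open>Continuity of \<Phi> pulls a neighbourhood of \<open>\<Phi> z\<close> back to one of
  \<open>z\<close>. The constant \<open>c\<close> will hold the entries of the loss that \<Phi>
  keeps fixed.\<close>

lemma local_minimizer_on_transfer:
  assumes min: "local_minimizer_on f S (\<Phi> z)" and z: "z \<in> S'" and cont: "isCont \<Phi> z"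
    and \<Phi>: "\<And>w. w \<in> S' \<Longrightarrow> \<Phi> w \<in> S" "\<And>w. w \<in> S' \<Longrightarrow> f (\<Phi> w) = g w + (c::real)"
  shows "local_minimizer_on g S' z"
proof -
  obtain e where e: "e > 0" "\<And>w. w \<in> S \<Longrightarrow> dist w (\<Phi> z) < e \<Longrightarrow> f (\<Phi> z) \<le> f w"
    using min by (auto simp: local_minimizer_on_def)
  obtain d where d: "d > 0" "\<And>w. dist w z < d \<Longrightarrow> dist (\<Phi> w) (\<Phi> z) < e"
    using cont e(1) by (auto simp: continuous_at_eps_delta)
  have "g z \<le> g w" if "w \<in> S'" "dist w z < d" for w
    using e(2)[OF \<Phi>(1) d(2)] \<Phi>(2) that z by fastforce
  with d(1) z show ?thesis
    by (auto simp: local_minimizer_on_def)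
qed

section \<open>Residual blocks\<close>

lemma rank_one_support_iff: "(i, j) \<in> rank_one_support I J k \<longleftrightarrow> (i, k) \<in> I \<and> (j, k) \<in> J"
  by (simp add: rank_one_support_def column_support_def)

lemma loss_sum: "loss A (X, Y) = (\<Sum>p\<in>UNIV. ((A - X \<odot> Y) $ fst p $ snd p)\<^sup>2)"
  unfolding loss_eq norm_matrix_power2 by (simp add: sum.cartesian_product case_prod_unfold)

lemma feasible_submatrix_zero: "(submatrix_zero X R P, submatrix_zero Y C P) \<in> feasible (R \<times> P) (C \<times> P)"
  by (simp add: feasible_iff submatrix_zero_nth)

text \<open>A column reaching a position off the CEC support lies in no CEC; its residual support
  then meets that of \<open>k\<close>, and by \<open>disj\<close> equals it. So each residual
  rectangle is served by one group of columns only.\<close>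

lemma residual_block_columns:
  assumes disj: "\<And>k l. k \<notin> CEC_indices I J \<Longrightarrow> l \<notin> CEC_indices I J \<Longrightarrow>
      residual_support I J k = residual_support I J l \<or>
      residual_support I J k \<inter> residual_support I J l = {}"
    and k: "k \<notin> CEC_indices I J" and ij: "(i, j) \<in> residual_support I J k"
    and l: "(i, j) \<in> rank_one_support I J l"
  shows "l \<notin> CEC_indices I J \<and> residual_support I J l = residual_support I J k"
proof -
  have nC: "(i, j) \<notin> CEC_support I J" using ij by (simp add: residual_support_def)
  then have lT: "l \<notin> CEC_indices I J"
    using rank_one_support_subset_CEC_support[of l I J] l by blast
  then show ?thesis
    using disj[OF k lT] ij l nC by (auto simp: residual_support_def)
qed

lemma mul_transpose_block:
  assumes disj: "\<And>k l. k \<notin> CEC_indices I J \<Longrightarrow> l \<notin> CEC_indices I J \<Longrightarrow>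
      residual_support I J k = residual_support I J l \<or>
      residual_support I J k \<inter> residual_support I J l = {}"
    and k: "k \<notin> CEC_indices I J" and Q: "residual_support I J k = R \<times> C"
    and P: "P = {l. l \<notin> CEC_indices I J \<and> residual_support I J l = R \<times> C}"
    and feas: "(X, Y) \<in> feasible I J" and ij: "i \<in> R" "j \<in> C"
  shows "(X \<odot> Y) $ i $ j = (submatrix_zero X R P \<odot> submatrix_zero Y C P) $ i $ j"
  unfolding mul_transpose_nth
proof (intro sum.cong refl)
  fix l
  have "X $ i $ l * Y $ j $ l = 0" if "l \<notin> P"
  proof (rule ccontr)
    assume "X $ i $ l * Y $ j $ l \<noteq> 0"
    then have "(i, l) \<in> I" "(j, l) \<in> J" using feas by (auto simp: feasible_iff)
    then have "(i, j) \<in> rank_one_support I J l" by (simp add: rank_one_support_iff)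
    moreover have "(i, j) \<in> residual_support I J k" using ij Q by simp
    ultimately show False
      using residual_block_columns[OF disj k] that Q by (simp add: P)
  qed
  then show "X $ i $ l * Y $ j $ l = submatrix_zero X R P $ i $ l * submatrix_zero Y C P $ j $ l"
    using ij by (auto simp: submatrix_zero_nth)
qed

text \<open>Only the columns in \<open>P\<close> reach \<open>R \<times> C\<close>, so the share of
  the loss on this rectangle depends on two submatrices. Applied to the minimizer, to its corrected
  perturbations and to a competitor.\<close>

lemma loss_block:
  assumes disj: "\<And>k l. k \<notin> CEC_indices I J \<Longrightarrow> l \<notin> CEC_indices I J \<Longrightarrow>
      residual_support I J k = residual_support I J l \<or>
      residual_support I J k \<inter> residual_support I J l = {}"
    and k: "k \<notin> CEC_indices I J" and Q: "residual_support I J k = R \<times> C"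
    and P: "P = {l. l \<notin> CEC_indices I J \<and> residual_support I J l = R \<times> C}"
    and feas: "(X, Y) \<in> feasible I J"
  shows "(\<Sum>p\<in>R \<times> C. ((A - X \<odot> Y) $ fst p $ snd p)\<^sup>2)
    = loss (submatrix_zero A R C) (submatrix_zero X R P, submatrix_zero Y C P)"
proof -
  let ?B = "submatrix_zero A R C" and ?X = "submatrix_zero X R P" and ?Y = "submatrix_zero Y C P"
  have out: "(?B - ?X \<odot> ?Y) $ fst p $ snd p = 0" if "p \<notin> R \<times> C" for p
    by (rule residual_outside_rectangle[OF feasible_submatrix_zero])
      (use that in \<open>auto simp: submatrix_zero_nth mem_Times_iff\<close>)
  have "(A - X \<odot> Y) $ fst p $ snd p = (?B - ?X \<odot> ?Y) $ fst p $ snd p" if "p \<in> R \<times> C" for p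
    using mul_transpose_block[OF disj k Q P feas, of "fst p" "snd p"] that
    by (auto simp: submatrix_zero_nth mem_Times_iff)
  then have "(\<Sum>p\<in>R \<times> C. ((A - X \<odot> Y) $ fst p $ snd p)\<^sup>2)
      = (\<Sum>p\<in>R \<times> C. ((?B - ?X \<odot> ?Y) $ fst p $ snd p)\<^sup>2)"
    by (intro sum.cong) auto
  also have "\<dots> = loss ?B (?X, ?Y)"
    unfolding loss_sum using out by (intro sum.mono_neutral_left) auto
  finally show ?thesis .
qed

text \<open>Perturbing the block also changes the product on the CEC support, which the full
  rank-one supports of its columns may meet. \<Phi> inserts the perturbation and the correction
  cancelling that spill, so only the entries on \<open>R \<times> C\<close> feel it and the loss of
  the block inherits local minimality.\<close>

lemma local_minimizer_block:
  fixes A :: "real^'n^'m" and X :: "real^'r^'m" and Y :: "real^'r^'n"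
  assumes disj: "\<And>k l. k \<notin> CEC_indices I J \<Longrightarrow> l \<notin> CEC_indices I J \<Longrightarrow>
      residual_support I J k = residual_support I J l \<or>
      residual_support I J k \<inter> residual_support I J l = {}"
    and k: "k \<notin> CEC_indices I J" and Q: "residual_support I J k = R \<times> C" and ne: "R \<times> C \<noteq> {}"
    and P: "P = {l. l \<notin> CEC_indices I J \<and> residual_support I J l = R \<times> C}"
    and min: "local_minimizer_on (loss A) (feasible I J) (X, Y)"
    and full: "CEC_full_rank I J (X, Y)"
  shows "local_minimizer_on (loss (submatrix_zero A R C)) (feasible (R \<times> P) (C \<times> P))
    (submatrix_zero X R P, submatrix_zero Y C P)"
proof -
  define X0 where "X0 = submatrix_zero X R P"
  define Y0 where "Y0 = submatrix_zero Y C P"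
  have feas: "(X, Y) \<in> feasible I J"
    using min by (simp add: local_minimizer_on_def)
  have P_IJ: "(i, l) \<in> I" "(j, l) \<in> J" if "l \<in> P" "i \<in> R" "j \<in> C" for i j l
  proof -
    have "(i, j) \<in> residual_support I J l" using that by (simp add: P)
    then have "(i, j) \<in> rank_one_support I J l" by (simp add: residual_support_def)
    then show "(i, l) \<in> I" "(j, l) \<in> J" by (simp_all add: rank_one_support_iff)
  qed
  \<comment> \<open>A position \<open>(i, j)\<close> of the rectangle certifies both memberships at
    once, so the inclusion for rows needs a column and conversely.\<close>
  then have sub: "R \<times> P \<subseteq> I" "C \<times> P \<subseteq> J" using ne by auto
  obtain TX TY K where TXY: "TX \<inter> TY = {}" "TX \<union> TY = CEC_indices I J" and lin: "linear K"
    and K: "\<And>G. K G \<in> feasible (I \<inter> UNIV \<times> TY) (J \<inter> UNIV \<times> TX)"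
    "\<And>G. fst (K G) \<odot> Y + X \<odot> snd (K G) =
      (\<chi> i j. if (i, j) \<in> CEC_support I J then G $ i $ j else 0)"
    by (rule CEC_correction[OF feas full]) (rule that)
  have TP: "l \<notin> TX" "l \<notin> TY" if "l \<in> P" for l
    using that TXY(2) by (auto simp: P)
  \<comment> \<open>The exact change of the product, quadratic term included, when the block
    \<open>(X0, Y0)\<close> becomes \<open>z\<close>. Feeding its negative to \<open>K\<close>
    cancels it on the CEC support.\<close>
  define G where "G z = (fst z - X0) \<odot> Y + X \<odot> (snd z - Y0) + (fst z - X0) \<odot> (snd z - Y0)" for z
  define \<Phi> where "\<Phi> z = (X, Y) + (z - (X0, Y0)) + K (- G z)" for z
  have feas_\<Phi>: "\<Phi> z \<in> feasible I J" if z: "z \<in> feasible (R \<times> P) (C \<times> P)" for z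
  proof -
    have "feasible (R \<times> P) (C \<times> P) \<subseteq> feasible I J"
      using sub by (auto simp: feasible_def)
    moreover have "feasible (I \<inter> UNIV \<times> TY) (J \<inter> UNIV \<times> TX) \<subseteq> feasible I J"
      by (auto simp: feasible_def)
    ultimately show ?thesis
      unfolding \<Phi>_def X0_def Y0_def using z K(1) feasible_submatrix_zero feas
      by (intro subspace_add subspace_diff subspace_feasible) blast+
  qed
  define c where "c = (\<Sum>p\<in>- (R \<times> C). ((A - X \<odot> Y) $ fst p $ snd p)\<^sup>2)"
  have loss_\<Phi>: "loss A (\<Phi> z) = loss (submatrix_zero A R C) z + c"
    if z: "z \<in> feasible (R \<times> P) (C \<times> P)" for z
  proof -
    obtain X1 Y1 where z1: "z = (X1, Y1)" by fastforce
    obtain U V where UV: "K (- G z) = (U, V)" by fastforce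
    have UV_feas: "(U, V) \<in> feasible (I \<inter> UNIV \<times> TY) (J \<inter> UNIV \<times> TX)"
      using K(1)[of "- G z"] UV by simp
    have U0: "U $ i $ l = 0" if "l \<notin> TY" for i l using UV_feas that by (simp add: feasible_iff)
    have V0: "V $ j $ l = 0" if "l \<notin> TX" for j l using UV_feas that by (simp add: feasible_iff)
    define X' where "X' = X1 - X0"
    define Y' where "Y' = Y1 - Y0"
    have X'0: "X' $ i $ l = 0" if "i \<notin> R \<or> l \<notin> P" for i l
      using that z by (auto simp: X'_def X0_def z1 feasible_iff submatrix_zero_nth)
    have Y'0: "Y' $ j $ l = 0" if "j \<notin> C \<or> l \<notin> P" for j l
      using that z by (auto simp: Y'_def Y0_def z1 feasible_iff submatrix_zero_nth)
    have X1_eq: "submatrix_zero (X + X' + U) R P = X1"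
      using z TP U0 by (auto simp: vec_eq_iff submatrix_zero_nth X'_def X0_def z1 feasible_iff)
    have Y1_eq: "submatrix_zero (Y + Y' + V) C P = Y1"
      using z TP V0 by (auto simp: vec_eq_iff submatrix_zero_nth Y'_def Y0_def z1 feasible_iff)
    have \<Phi>_eq: "\<Phi> z = (X + X' + U, Y + Y' + V)"
      unfolding \<Phi>_def UV by (simp add: z1 X'_def Y'_def)
    have G_eq: "G z = X' \<odot> Y + X \<odot> Y' + X' \<odot> Y'"
      by (simp add: G_def z1 X'_def Y'_def)
    \<comment> \<open>The correction uses CEC columns, the block columns in \<open>P\<close>, and
      \<open>U\<close> and \<open>V\<close> share none: all second-order products involving the
      correction vanish.\<close>
    have "X' \<odot> V = 0"
      by (rule mul_transpose_disjoint_columns[of P]) (use X'0 V0 TP in auto)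
    moreover have "U \<odot> Y' = 0"
      by (rule mul_transpose_disjoint_columns[of "- P"]) (use Y'0 U0 TP in auto)
    moreover have "U \<odot> V = 0"
      by (rule mul_transpose_disjoint_columns[of TY]) (use U0 in blast, use V0 TXY(1) in blast)
    ultimately have prod: "(X + X' + U) \<odot> (Y + Y' + V) = X \<odot> Y + G z + (U \<odot> Y + X \<odot> V)"
      by (simp add: G_eq mul_transpose_add_left mul_transpose_add_right)
    have same: "(A - (X + X' + U) \<odot> (Y + Y' + V)) $ i $ j = (A - X \<odot> Y) $ i $ j"
      if ij: "(i, j) \<notin> R \<times> C" for i j
    proof (cases "(i, j) \<in> CEC_support I J")
      case True
      then show ?thesis
        using K(2)[of "- G z"] by (simp add: prod UV vec_eq_iff)
    next
      case False
      \<comment> \<open>Off the CEC support a column of \<open>P\<close> reaches exactly the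
        positions of its residual support \<open>R \<times> C\<close>, so outside both sets the
        block has no influence.\<close>
      have "G z $ i $ j = 0"
      proof -
        have "X' $ i $ l * Y $ j $ l + X $ i $ l * Y' $ j $ l + X' $ i $ l * Y' $ j $ l = 0" for l
        proof (cases "l \<in> P \<and> (i, l) \<in> I \<and> (j, l) \<in> J")
          case True
          then have "(i, j) \<in> residual_support I J l"
            using False by (simp add: residual_support_def rank_one_support_iff)
          with True ij show ?thesis by (simp add: P)
        next
          case False
          then consider "l \<notin> P" | "(i, l) \<notin> I" | "(j, l) \<notin> J" by blast
          then show ?thesis
          proof cases
            case 2
            then have "X $ i $ l = 0" "X' $ i $ l = 0"
              using feas X'0[of i l] sub by (auto simp: feasible_iff)
            then show ?thesis by simp
          next
            case 3
            then have "Y $ j $ l = 0" "Y' $ j $ l = 0"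
              using feas Y'0[of j l] sub by (auto simp: feasible_iff)
            then show ?thesis by simp
          qed (simp add: X'0 Y'0)
        qed
        then show ?thesis
          by (simp add: G_eq mul_transpose_nth flip: sum.distrib)
      qed
      moreover have "(U \<odot> Y + X \<odot> V) $ i $ j = 0"
        using K(2)[of "- G z"] False by (simp add: UV)
      ultimately show ?thesis
        by (simp add: prod)
    qed
    have "loss A (\<Phi> z) = (\<Sum>p\<in>R \<times> C. ((A - (X + X' + U) \<odot> (Y + Y' + V)) $ fst p $ snd p)\<^sup>2)
        + (\<Sum>p\<in>- (R \<times> C). ((A - (X + X' + U) \<odot> (Y + Y' + V)) $ fst p $ snd p)\<^sup>2)"
      unfolding \<Phi>_eq loss_sum by (subst sum.union_disjoint[symmetric]) auto
    also have "(\<Sum>p\<in>- (R \<times> C). ((A - (X + X' + U) \<odot> (Y + Y' + V)) $ fst p $ snd p)\<^sup>2) = c"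
      unfolding c_def by (intro sum.cong refl) (metis ComplD prod.collapse same)
    also have "(\<Sum>p\<in>R \<times> C. ((A - (X + X' + U) \<odot> (Y + Y' + V)) $ fst p $ snd p)\<^sup>2)
        = loss (submatrix_zero A R C) z"
      using loss_block[OF disj k Q P feas_\<Phi>[OF z, unfolded \<Phi>_eq], of A]
      by (simp add: X1_eq Y1_eq z1)
    finally show ?thesis .
  qed
  have "local_minimizer_on (loss (submatrix_zero A R C)) (feasible (R \<times> P) (C \<times> P)) (X0, Y0)"
  proof (rule local_minimizer_on_transfer[where f = "loss A" and \<Phi> = \<Phi> and c = c])
    have "K 0 = 0" using lin by (rule linear_0)
    then have "\<Phi> (X0, Y0) = (X, Y)" by (simp add: \<Phi>_def G_def zero_prod_def mul_transpose_zero_left mul_transpose_zero_right)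
    then show "local_minimizer_on (loss A) (feasible I J) (\<Phi> (X0, Y0))" using min by simp
    show "(X0, Y0) \<in> feasible (R \<times> P) (C \<times> P)"
      unfolding X0_def Y0_def by (rule feasible_submatrix_zero)
    have "continuous_on UNIV G"
      unfolding G_def by (intro continuous_intros continuous_on_mul_transpose)
    then have "continuous_on UNIV (\<lambda>z. K (- G z))"
      using lin by (intro bounded_linear.continuous_on[of K] continuous_on_minus)
        (simp_all add: linear_conv_bounded_linear)
    then have "continuous_on UNIV \<Phi>"
      unfolding \<Phi>_def by (intro continuous_intros)
    then show "isCont \<Phi> (X0, Y0)" by (simp add: continuous_on_eq_continuous_at)
  qed (rule feas_\<Phi> loss_\<Phi>; assumption)+
  then show ?thesis by (simp add: X0_def Y0_def)
qed

text \<open>Every position is of one of three kinds. On a residual rectangle the block problem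
  compares the losses; on the CEC support the minimizer has zero residual; elsewhere no column
  reaches, so all feasible products vanish and the losses agree.\<close>

lemma CEC_full_rank_not_spurious:
  fixes A :: "real^'n^'m" and X :: "real^'r^'m" and Y :: "real^'r^'n"
  assumes rect: "\<And>k. k \<notin> CEC_indices I J \<Longrightarrow> rectangular (residual_support I J k)"
    and disj: "\<And>k l. k \<notin> CEC_indices I J \<Longrightarrow> l \<notin> CEC_indices I J \<Longrightarrow>
      residual_support I J k = residual_support I J l \<or>
      residual_support I J k \<inter> residual_support I J l = {}"
    and full: "CEC_full_rank I J (X, Y)"
  shows "\<not> spurious_local_min_on (loss A) (feasible I J) (X, Y)"
proof -
  have "loss A (X, Y) \<le> loss A (X', Y')"
    if min: "local_minimizer_on (loss A) (feasible I J) (X, Y)"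
      and feas': "(X', Y') \<in> feasible I J" for X' Y'
  proof -
    have feas: "(X, Y) \<in> feasible I J" using min by (simp add: local_minimizer_on_def)
    define e where "e = (\<lambda>p. ((A - X \<odot> Y) $ fst p $ snd p)\<^sup>2)"
    define e' where "e' = (\<lambda>p. ((A - X' \<odot> Y') $ fst p $ snd p)\<^sup>2)"
    \<comment> \<open>Taken as a set, so columns with the same residual support yield one block, and
      distinct members are disjoint by \<open>disj\<close>.\<close>
    define \<Q> where "\<Q> = residual_support I J ` (- CEC_indices I J)"
    have block: "sum e Q \<le> sum e' Q" if "Q \<in> \<Q>" for Q
    proof (cases "Q = {}")
      case False
      obtain k where k: "k \<notin> CEC_indices I J" "residual_support I J k = Q"
        using \<open>Q \<in> \<Q>\<close> by (auto simp: \<Q>_def)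
      then obtain R C where Q: "Q = R \<times> C" using rect[OF k(1)] k(2) by (auto simp: rectangular_def)
      define P where "P = {l. l \<notin> CEC_indices I J \<and> residual_support I J l = R \<times> C}"
      note k' = k(1) k(2)[unfolded Q]
      have "global_minimizer_on (loss (submatrix_zero A R C)) (feasible (R \<times> P) (C \<times> P))
          (submatrix_zero X R P, submatrix_zero Y C P)"
        using local_minimizer_block[OF disj k' _ P_def min full] False Q
        by (intro low_rank_no_spurious_local_minimizer) (auto simp: submatrix_zero_nth)
      moreover have "sum e Q = loss (submatrix_zero A R C) (submatrix_zero X R P, submatrix_zero Y C P)"
        unfolding Q e_def by (rule loss_block[OF disj k' P_def feas])
      moreover have "sum e' Q = loss (submatrix_zero A R C) (submatrix_zero X' R P, submatrix_zero Y' C P)"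
        unfolding Q e'_def by (rule loss_block[OF disj k' P_def feas'])
      ultimately show ?thesis
        by (simp add: global_minimizer_on_def feasible_submatrix_zero)
    qed simp
    have rest: "e p \<le> e' p" if "p \<notin> \<Union>\<Q>" for p
    proof (cases "p \<in> CEC_support I J")
      case True
      then have "e p = 0"
        using CEC_residual_zero[OF min full, of "fst p" "snd p"] by (simp add: e_def)
      then show ?thesis by (simp add: e'_def)
    next
      case False
      have no: "(fst p, l) \<notin> I \<or> (snd p, l) \<notin> J" for l
      proof (rule ccontr)
        assume "\<not> ?thesis"
        then have l: "p \<in> rank_one_support I J l"
          using rank_one_support_iff[of "fst p" "snd p" I J l] by simp
        with False have "l \<notin> CEC_indices I J"
          using rank_one_support_subset_CEC_support[of l I J] by blast
        moreover have "p \<in> residual_support I J l" using l False by (simp add: residual_support_def)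
        ultimately show False using that by (auto simp: \<Q>_def)
      qed
      have "(X \<odot> Y) $ fst p $ snd p = 0" "(X' \<odot> Y') $ fst p $ snd p = 0"
        unfolding mul_transpose_nth using feas feas' no
        by (auto simp: feasible_iff intro!: sum.neutral) metis+
      then show ?thesis by (simp add: e_def e'_def)
    qed
    have split: "sum h UNIV = (\<Sum>Q\<in>\<Q>. sum h Q) + sum h (- \<Union>\<Q>)" for h :: "_ \<Rightarrow> real"
    proof -
      have "sum h UNIV = sum h (\<Union>\<Q>) + sum h (- \<Union>\<Q>)"
        by (subst sum.union_disjoint[symmetric]) auto
      also have "sum h (\<Union>\<Q>) = (\<Sum>Q\<in>\<Q>. sum h Q)"
      proof -
        have "Q \<inter> Q' = {}" if "Q \<in> \<Q>" "Q' \<in> \<Q>" "Q \<noteq> Q'" for Q Q'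
          using disj that by (auto simp: \<Q>_def)
        then show ?thesis by (subst sum.Union_disjoint) auto
      qed
      finally show ?thesis .
    qed
    have "loss A (X, Y) = (\<Sum>Q\<in>\<Q>. sum e Q) + sum e (- \<Union>\<Q>)"
      using split[of e] by (simp add: loss_sum e_def)
    also have "\<dots> \<le> (\<Sum>Q\<in>\<Q>. sum e' Q) + sum e' (- \<Union>\<Q>)"
      by (rule add_mono; rule sum_mono) (use block rest in auto)
    also have "\<dots> = loss A (X', Y')"
      using split[of e'] by (simp add: loss_sum e'_def)
    finally show ?thesis .
  qed
  then show ?thesis
    unfolding spurious_local_min_on_def global_minimizer_on_def
    by (metis local_minimizer_on_def surj_pair)
qed

section \<open>Paths to CEC-full-rank points\<close>

lemma path_component_segment:
  fixes X U :: "real^'r^'m" and Y V :: "real^'r^'n"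
  assumes "(X, Y) \<in> feasible I J" "(U, V) \<in> feasible I J"
    and "U \<odot> Y = 0" "X \<odot> V = 0" "U \<odot> V = 0"
  shows "path_component {z \<in> feasible I J. fst z \<odot> snd z = X \<odot> Y} (X, Y) (X + U, Y + V)"
proof (rule path_component_linepath, rule subsetI)
  fix z assume "z \<in> closed_segment (X, Y) (X + U, Y + V)"
  then obtain t where t: "z = (1 - t) *\<^sub>R (X, Y) + t *\<^sub>R (X + U, Y + V)"
    by (auto simp: in_segment)
  have z: "z = (X + t *\<^sub>R U, Y + t *\<^sub>R V)"
    by (simp add: t algebra_simps)
  have "(X, Y) + t *\<^sub>R (U, V) \<in> feasible I J"
    using assms(1,2) by (intro subspace_add subspace_scale subspace_feasible)
  then show "z \<in> {z \<in> feasible I J. fst z \<odot> snd z = X \<odot> Y}"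
    using assms(3-) by (simp add: z mul_transpose_add_left mul_transpose_add_right
        mul_transpose_scaleR_left mul_transpose_scaleR_right)
qed

lemma path_component_prod_swap:
  assumes "path_component S x y" "prod.swap ` S \<subseteq> T"
  shows "path_component T (prod.swap x) (prod.swap y)"
proof -
  obtain g where g: "path g" "path_image g \<subseteq> S" "pathstart g = x" "pathfinish g = y"
    using assms(1) by (auto simp: path_component_def)
  have "path (prod.swap \<circ> g)"
    using g(1) by (intro path_continuous_image continuous_on_swap)
  moreover have "path_image (prod.swap \<circ> g) \<subseteq> T"
    using g(2) assms(2) by (auto simp: path_image_compose)
  ultimately show ?thesis
    using g(3,4) unfolding path_component_def
    by (intro exI[of _ "prod.swap \<circ> g"]) (auto simp: pathstart_def pathfinish_def)
qed

text \<open>A kernel vector \<open>w\<close> of \<open>X\<close> with \<open>w $ k = 1\<close> allows to move \<open>Y\<close> until its column \<open>k\<close>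
  vanishes; column \<open>k\<close> of \<open>X\<close> is then free and can leave the column space.\<close>

lemma rank_increasing_path:
  fixes X :: "real^'r^'m" and Y :: "real^'r^'n"
  assumes feas: "(X, Y) \<in> feasible I J"
    and I: "\<And>i k. k \<in> P \<Longrightarrow> (i, k) \<in> I \<longleftrightarrow> i \<in> R" and J: "\<And>j k. k \<in> P \<Longrightarrow> (j, k) \<in> J \<longleftrightarrow> j \<in> C"
    and card: "card R \<le> card P" and deficient: "\<not> full_row_rank_on X R P"
  shows "\<exists>X' Y'. path_component {z \<in> feasible I J. fst z \<odot> snd z = X \<odot> Y} (X, Y) (X', Y') \<and>
    (\<forall>i k. k \<notin> P \<longrightarrow> X' $ i $ k = X $ i $ k) \<and> (\<forall>j k. k \<notin> P \<longrightarrow> Y' $ j $ k = Y $ j $ k) \<and>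
    rank (submatrix_zero X R P) < rank (submatrix_zero X' R P)"
proof -
  define M where "M = submatrix_zero X R P"
  define S where "S = range ((*v) M)"
  define VR where "VR = {x::real^'m. \<forall>i. i \<notin> R \<longrightarrow> x $ i = 0}"
  define W where "W = {w::real^'r. \<forall>k. k \<notin> P \<longrightarrow> w $ k = 0}"
  have W: "subspace W" "dim W = card P" and VR: "subspace VR" "dim VR = card R"
    unfolding W_def VR_def by (rule subspace_vectors_supported_on dim_vectors_supported_on)+
  have S: "subspace S" "S \<subseteq> VR"
    unfolding S_def VR_def M_def
    by (intro linear_subspace_image matrix_vector_mul_linear subspace_UNIV range_submatrix_zero)+
  have rank: "rank M = dim S" by (simp add: rank_dim_range S_def)
  then have dimS: "dim S < card R"
    using deficient dim_subset[OF S(2)] VR(2) by (simp add: full_row_rank_on_def M_def)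
  have MX: "M *v v = X *v v" if "v \<in> W" for v
  proof -
    have "X $ i $ k = 0" if "k \<in> P" "i \<notin> R" for i k
      using feas I that by (auto simp: feasible_iff)
    moreover have "(\<chi> k. if k \<in> P then v $ k else 0) = v"
      using that by (auto simp: W_def vec_eq_iff)
    ultimately show ?thesis
      by (simp add: M_def submatrix_zero_mult_vector)
  qed
  \<comment> \<open>Injectivity on \<open>W\<close> would force \<open>card P \<le> dim S\<close>,
    against \<open>dim S < card R \<le> card P\<close>.\<close>
  have "\<exists>v\<in>W. v \<noteq> 0 \<and> M *v v = 0"
  proof (rule ccontr)
    assume "\<not> ?thesis"
    then have "inj_on ((*v) M) W"
      unfolding linear_inj_on_iff_eq_0[OF matrix_vector_mul_linear W(1)] by blast
    then have "dim ((*v) M ` W) = card P"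
      using dim_image_eq[OF matrix_vector_mul_linear, of M W] W by (simp add: span_eq_iff[THEN iffD2])
    moreover have "dim ((*v) M ` W) \<le> dim S"
      unfolding S_def by (rule dim_subset) blast
    ultimately show False using dimS card by simp
  qed
  then obtain v where v: "v \<in> W" "v \<noteq> 0" "M *v v = 0" by blast
  then obtain k where k: "v $ k \<noteq> 0" by (auto simp: vec_eq_iff)
  have kP: "k \<in> P" using v(1) k by (auto simp: W_def)
  define w where "w = v /\<^sub>R (v $ k)"
  have w: "w \<in> W" "w $ k = 1" "M *v w = 0"
    using v k W(1) by (auto simp: w_def subspace_scale matrix_vector_mult_scaleR)
  have Xw: "X *v w = 0" using MX[OF w(1)] w(3) by simp
  have "S \<noteq> VR" using dimS VR(2) by auto
  then obtain z where z: "z \<in> VR" "z \<notin> S" using S(2) by blast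
  define y where "y = column k Y"
  define X' where "X' = X + outer z (axis k 1)"
  define Y' where "Y' = Y + - outer y w"
  have "path_component {z \<in> feasible I J. fst z \<odot> snd z = X \<odot> Y} (X, Y) (X + 0, Y')"
    unfolding Y'_def
  proof (rule path_component_segment[OF feas])
    have "(j, l) \<in> J" if "y $ j \<noteq> 0" "w $ l \<noteq> 0" for j l
    proof -
      have "(j, k) \<in> J" using feas that(1) by (auto simp: y_def column_def feasible_iff)
      moreover have "l \<in> P" using w(1) that(2) by (auto simp: W_def)
      ultimately show ?thesis using J kP by blast
    qed
    then show "(0, - outer y w) \<in> feasible I J"
      by (auto simp: feasible_iff outer_nth)
    have "X \<odot> (- 1 *\<^sub>R outer y w) = 0"
      by (simp only: mul_transpose_scaleR_right mul_transpose_outer_right Xw outer_zero_left) simp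
    then show "X \<odot> - outer y w = 0" by simp
  qed (simp_all add: mul_transpose_zero_left)
  moreover have "path_component {z \<in> feasible I J. fst z \<odot> snd z = X \<odot> Y} (X, Y') (X', Y' + 0)"
  proof -
    have mem: "(X, Y') \<in> feasible I J" "X \<odot> Y' = X \<odot> Y"
      using path_component_mem(2)[OF calculation] by simp_all
    have "Y' *v axis k 1 = 0"
      by (simp add: matrix_vector_mult_basis vec_eq_iff column_def Y'_def outer_nth y_def w(2))
    then have "outer z (axis k 1) \<odot> Y' = 0"
      by (simp add: mul_transpose_outer_left outer_zero_right)
    moreover have "(outer z (axis k 1), 0) \<in> feasible I J"
      using z(1) I[OF kP] by (auto simp: feasible_iff outer_nth axis_def VR_def)
    ultimately show ?thesis
      unfolding X'_def mem(2)[symmetric]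
      by (intro path_component_segment mem(1)) (simp_all add: mul_transpose_zero_right)
  qed
  ultimately have path: "path_component {z \<in> feasible I J. fst z \<odot> snd z = X \<odot> Y} (X, Y) (X', Y')"
    by simp (rule path_component_trans)
  define M' where "M' = submatrix_zero X' R P"
  have M': "M' = M + outer z (axis k 1)"
    using z(1) kP by (auto simp: M'_def M_def X'_def vec_eq_iff submatrix_zero_nth outer_nth VR_def axis_def)
  have M'w: "M' *v w = z"
    by (simp add: M' matrix_vector_mult_add_rdistrib w outer_matrix_vector_mult inner_axis')
  \<comment> \<open>The old range survives: subtracting \<open>(u $ k) *\<^sub>R w\<close> makes
    coordinate \<open>k\<close> zero, where the added rank-one term acts, and costs nothing since
    \<open>M *v w = 0\<close>. The vector \<open>w\<close> itself now produces the new direction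
    \<open>z\<close>.\<close>
  have sub: "M *v u = M' *v (u - (u $ k) *\<^sub>R w)" for u
    by (simp add: M' matrix_vector_mult_add_rdistrib matrix_vector_mult_diff_distrib
        matrix_vector_mult_scaleR w outer_matrix_vector_mult inner_axis')
  have "S \<subset> range ((*v) M')"
  proof
    show "S \<subseteq> range ((*v) M')" unfolding S_def using sub by (metis image_subsetI rangeI)
    show "S \<noteq> range ((*v) M')" using z(2) M'w by (metis rangeI)
  qed
  moreover have "subspace (range ((*v) M'))"
    by (intro linear_subspace_image matrix_vector_mul_linear subspace_UNIV)
  ultimately have "span S \<subset> span (range ((*v) M'))"
    using S(1) by (simp only: span_eq_iff[THEN iffD2])
  then have "dim S < dim (range ((*v) M'))"
    by (rule dim_psubset)
  then have "rank M < rank M'"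
    by (simp only: rank rank_dim_range[of M'])
  moreover have "X' $ i $ l = X $ i $ l" if "l \<notin> P" for i l
    using that kP by (auto simp: X'_def outer_nth axis_def)
  moreover have "Y' $ j $ l = Y $ j $ l" if "l \<notin> P" for j l
    using that w(1) by (auto simp: Y'_def outer_nth W_def)
  ultimately show ?thesis
    using path unfolding M_def M'_def by blast
qed

lemma full_row_rank_path:
  fixes X :: "real^'r^'m" and Y :: "real^'r^'n"
  assumes feas: "(X, Y) \<in> feasible I J"
    and I: "\<And>i k. k \<in> P \<Longrightarrow> (i, k) \<in> I \<longleftrightarrow> i \<in> R" and J: "\<And>j k. k \<in> P \<Longrightarrow> (j, k) \<in> J \<longleftrightarrow> j \<in> C"
    and card: "card R \<le> card P"
  shows "\<exists>X' Y'. path_component {z \<in> feasible I J. fst z \<odot> snd z = X \<odot> Y} (X, Y) (X', Y') \<and>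
    (\<forall>i k. k \<notin> P \<longrightarrow> X' $ i $ k = X $ i $ k) \<and> (\<forall>j k. k \<notin> P \<longrightarrow> Y' $ j $ k = Y $ j $ k) \<and>
    full_row_rank_on X' R P"
  using feas
proof (induction "card R - rank (submatrix_zero X R P)" arbitrary: X Y rule: less_induct)
  case less
  show ?case
  proof (cases "full_row_rank_on X R P")
    case True
    then show ?thesis
      using less.prems by (intro exI[of _ X] exI[of _ Y]) (auto simp: path_component_refl_eq)
  next
    case False
    have "\<exists>X1 Y1. path_component {z \<in> feasible I J. fst z \<odot> snd z = X \<odot> Y} (X, Y) (X1, Y1) \<and>
        (\<forall>i k. k \<notin> P \<longrightarrow> X1 $ i $ k = X $ i $ k) \<and> (\<forall>j k. k \<notin> P \<longrightarrow> Y1 $ j $ k = Y $ j $ k) \<and>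
        rank (submatrix_zero X R P) < rank (submatrix_zero X1 R P)"
      by (rule rank_increasing_path[OF less.prems I J card False])
    then obtain X1 Y1 where 1:
      "path_component {z \<in> feasible I J. fst z \<odot> snd z = X \<odot> Y} (X, Y) (X1, Y1)"
      "\<forall>i k. k \<notin> P \<longrightarrow> X1 $ i $ k = X $ i $ k" "\<forall>j k. k \<notin> P \<longrightarrow> Y1 $ j $ k = Y $ j $ k"
      "rank (submatrix_zero X R P) < rank (submatrix_zero X1 R P)"
      by blast
    have mem: "(X1, Y1) \<in> feasible I J" "X1 \<odot> Y1 = X \<odot> Y"
      using path_component_mem(2)[OF 1(1)] by simp_all
    \<comment> \<open>With truncated subtraction the deficit drops only if the old rank is below
      \<open>card R\<close>; the bound on the larger new rank ensures this.\<close>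
    have "rank (submatrix_zero X1 R P) \<le> card R"
      using dim_subset[OF range_submatrix_zero[of X1 R P]]
      by (simp add: rank_dim_range dim_vectors_supported_on)
    then have "card R - rank (submatrix_zero X1 R P) < card R - rank (submatrix_zero X R P)"
      using 1(4) by simp
    then obtain X2 Y2 where 2:
      "path_component {z \<in> feasible I J. fst z \<odot> snd z = X \<odot> Y} (X1, Y1) (X2, Y2)"
      "\<forall>i k. k \<notin> P \<longrightarrow> X2 $ i $ k = X1 $ i $ k" "\<forall>j k. k \<notin> P \<longrightarrow> Y2 $ j $ k = Y1 $ j $ k"
      "full_row_rank_on X2 R P"
      using less.hyps[OF _ mem(1)] mem(2) by auto
    show ?thesis
      using path_component_trans[OF 1(1) 2(1)] 1(2,3) 2(2-4)
      by (intro exI[of _ X2] exI[of _ Y2]) auto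
  qed
qed

lemma full_row_rank_on_empty: "full_row_rank_on M {} P"
proof -
  have "submatrix_zero M {} P = 0" by (simp add: vec_eq_iff submatrix_zero_nth)
  then show ?thesis by (simp add: full_row_rank_on_def)
qed

lemma full_row_rank_on_cong:
  assumes "\<And>i k. k \<in> P \<Longrightarrow> M $ i $ k = N $ i $ k"
  shows "full_row_rank_on M R P \<longleftrightarrow> full_row_rank_on N R P"
proof -
  have "submatrix_zero M R P = submatrix_zero N R P"
    using assms by (simp add: vec_eq_iff submatrix_zero_nth)
  then show ?thesis by (simp add: full_row_rank_on_def)
qed

text \<open>The minimum in the definition of a CEC decides which factor is raised to full row rank;
  the column case is the row case with the factors exchanged.\<close>

lemma CEC_path:
  fixes X :: "real^'r^'m" and Y :: "real^'r^'n"
  assumes feas: "(X, Y) \<in> feasible I J" and P: "P \<in> CECs I J"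
  shows "\<exists>X' Y'. path_component {z \<in> feasible I J. fst z \<odot> snd z = X \<odot> Y} (X, Y) (X', Y') \<and>
    (\<forall>i k. k \<notin> P \<longrightarrow> X' $ i $ k = X $ i $ k) \<and> (\<forall>j k. k \<notin> P \<longrightarrow> Y' $ j $ k = Y $ j $ k) \<and>
    (full_row_rank_on X' (class_rows I P) P \<or> full_row_rank_on Y' (class_cols J P) P)"
proof (cases "class_support I J P = {}")
  \<comment> \<open>With empty support the members of \<open>P\<close> need not share their rows and
    columns, but the row or the column set is empty and full row rank is trivial, so the constant
    path serves.\<close>
  case True
  then have "class_rows I P = {} \<or> class_cols J P = {}"
    by (simp add: class_support_def rank_one_support_def class_rows_def class_cols_def)
  then have "full_row_rank_on X (class_rows I P) P \<or> full_row_rank_on Y (class_cols J P) P"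
    using full_row_rank_on_empty[of X P] full_row_rank_on_empty[of Y P] by auto
  then show ?thesis
    using feas by (intro exI[of _ X] exI[of _ Y]) (auto simp: path_component_refl_eq)
next
  case False
  have I: "(i, k) \<in> I \<longleftrightarrow> i \<in> class_rows I P" if "k \<in> P" for i k
    using class_rows_cols_eq(1)[OF CEC_class[OF P] that False] by (simp add: column_support_def)
  have J: "(j, k) \<in> J \<longleftrightarrow> j \<in> class_cols J P" if "k \<in> P" for j k
    using class_rows_cols_eq(2)[OF CEC_class[OF P] that False] by (simp add: column_support_def)
  consider "card (class_rows I P) \<le> card P" | "card (class_cols J P) \<le> card P"
    using P by (auto simp: CECs_def min_le_iff_disj)
  then show ?thesis
  proof cases
    case 1
    have "\<exists>X' Y'. path_component {z \<in> feasible I J. fst z \<odot> snd z = X \<odot> Y} (X, Y) (X', Y') \<and>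
        (\<forall>i k. k \<notin> P \<longrightarrow> X' $ i $ k = X $ i $ k) \<and> (\<forall>j k. k \<notin> P \<longrightarrow> Y' $ j $ k = Y $ j $ k) \<and>
        full_row_rank_on X' (class_rows I P) P"
      by (rule full_row_rank_path[OF feas I J 1])
    then show ?thesis by blast
  next
    case 2
    have "\<exists>Y' X'. path_component {z \<in> feasible J I. fst z \<odot> snd z = Y \<odot> X} (Y, X) (Y', X') \<and>
        (\<forall>j k. k \<notin> P \<longrightarrow> Y' $ j $ k = Y $ j $ k) \<and> (\<forall>i k. k \<notin> P \<longrightarrow> X' $ i $ k = X $ i $ k) \<and>
        full_row_rank_on Y' (class_cols J P) P"
      by (rule full_row_rank_path[OF feasible_swap[THEN iffD2, OF feas] J I 2])
    then obtain X' Y' where path: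
      "path_component {z \<in> feasible J I. fst z \<odot> snd z = Y \<odot> X} (Y, X) (Y', X')"
      and cols: "\<forall>j k. k \<notin> P \<longrightarrow> Y' $ j $ k = Y $ j $ k" "\<forall>i k. k \<notin> P \<longrightarrow> X' $ i $ k = X $ i $ k"
      and full: "full_row_rank_on Y' (class_cols J P) P"
      by blast
    have "prod.swap ` {z \<in> feasible J I. fst z \<odot> snd z = Y \<odot> X}
        \<subseteq> {z \<in> feasible I J. fst z \<odot> snd z = X \<odot> Y}"
    proof (rule image_subsetI)
      fix z assume z: "z \<in> {z \<in> feasible J I. fst z \<odot> snd z = Y \<odot> X}"
      obtain U V where UV: "z = (U, V)" by fastforce
      have "U \<odot> V = Y \<odot> X" "(U, V) \<in> feasible J I" using z UV by simp_all
      moreover from this have "V \<odot> U = X \<odot> Y" by (metis transpose_mul_transpose)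
      ultimately show "prod.swap z \<in> {z \<in> feasible I J. fst z \<odot> snd z = X \<odot> Y}"
        using feasible_swap[of U V J I] by (simp add: UV)
    qed
    then have "path_component {z \<in> feasible I J. fst z \<odot> snd z = X \<odot> Y} (X, Y) (X', Y')"
      using path_component_prod_swap[OF path] by simp
    with cols full show ?thesis by blast
  qed
qed

text \<open>CECs can be treated one after another: the path for \<open>P\<close> alters only columns
  in \<open>P\<close>, classes are disjoint, and full row rank of a class depends only on its own
  columns.\<close>

lemma CEC_full_rank_path:
  fixes X :: "real^'r^'m" and Y :: "real^'r^'n"
  assumes feas: "(X, Y) \<in> feasible I J"
  shows "\<exists>X' Y'. path_component {z \<in> feasible I J. fst z \<odot> snd z = X \<odot> Y} (X, Y) (X', Y') \<and>
    CEC_full_rank I J (X', Y')"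
proof -
  have "\<exists>X' Y'. path_component {z \<in> feasible I J. fst z \<odot> snd z = X \<odot> Y} (X, Y) (X', Y') \<and>
      (\<forall>P\<in>F. full_row_rank_on X' (class_rows I P) P \<or> full_row_rank_on Y' (class_cols J P) P)"
    if "finite F" "F \<subseteq> CECs I J" for F
    using that
  proof (induction F rule: finite_induct)
    case empty
    show ?case using feas by (intro exI[of _ X] exI[of _ Y]) (auto simp: path_component_refl_eq)
  next
    case (insert P F)
    then obtain X1 Y1 where 1:
      "path_component {z \<in> feasible I J. fst z \<odot> snd z = X \<odot> Y} (X, Y) (X1, Y1)"
      "\<And>Q. Q \<in> F \<Longrightarrow> full_row_rank_on X1 (class_rows I Q) Q \<or> full_row_rank_on Y1 (class_cols J Q) Q"
      by auto
    have mem: "(X1, Y1) \<in> feasible I J" "X1 \<odot> Y1 = X \<odot> Y"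
      using path_component_mem(2)[OF 1(1)] by simp_all
    have P: "P \<in> CECs I J" using insert.prems by blast
    obtain X2 Y2 where 2:
      "path_component {z \<in> feasible I J. fst z \<odot> snd z = X \<odot> Y} (X1, Y1) (X2, Y2)"
      "\<And>i k. k \<notin> P \<Longrightarrow> X2 $ i $ k = X1 $ i $ k" "\<And>j k. k \<notin> P \<Longrightarrow> Y2 $ j $ k = Y1 $ j $ k"
      "full_row_rank_on X2 (class_rows I P) P \<or> full_row_rank_on Y2 (class_cols J P) P"
      using CEC_path[OF mem(1) P] unfolding mem(2) by auto
    have "full_row_rank_on X2 (class_rows I Q) Q \<or> full_row_rank_on Y2 (class_cols J Q) Q"
      if Q: "Q \<in> F" for Q
    proof -
      have "Q \<in> CECs I J" "Q \<noteq> P" using Q insert.prems insert.hyps by auto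
      then have "k \<notin> P" if "k \<in> Q" for k
        using support_classes_disjoint[OF CEC_class CEC_class] P that by blast
      then show ?thesis
        using 1(2)[OF Q] full_row_rank_on_cong[of Q X2 X1] full_row_rank_on_cong[of Q Y2 Y1] 2(2,3)
        by blast
    qed
    then show ?case
      using path_component_trans[OF 1(1) 2(1)] 2(4) by blast
  qed
  from this[OF finite order_refl] show ?thesis
    by (auto simp: CEC_full_rank_def)
qed

theorem theorem4p19:
  fixes A :: "real^'n^'m"
    and I :: "('m \<times> 'r::finite) set" and J :: "('n \<times> 'r) set"
    and X :: "real^'r^'m" and Y :: "real^'r^'n"
  assumes rect: "\<And>k. k \<notin> CEC_indices I J \<Longrightarrow> rectangular (residual_support I J k)"
    and disj: "\<And>k l. k \<notin> CEC_indices I J \<Longrightarrow> l \<notin> CEC_indices I J \<Longrightarrow>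
      residual_support I J k = residual_support I J l \<or>
      residual_support I J k \<inter> residual_support I J l = {}"
    and feas: "(X, Y) \<in> feasible I J"
  shows "(CEC_full_rank I J (X, Y) \<longrightarrow>
            \<not> spurious_local_min_on (loss A) (feasible I J) (X, Y)) \<and>
         (\<not> CEC_full_rank I J (X, Y) \<longrightarrow>
            (\<exists>\<gamma> X' Y'. feasible_path I J \<gamma> \<and>
               pathstart \<gamma> = (X, Y) \<and> pathfinish \<gamma> = (X', Y') \<and>
               (X', Y') \<in> feasible I J \<and>
               (\<forall>t\<in>{0..1}. loss A (\<gamma> t) = loss A (X, Y)) \<and>
               \<not> spurious_local_min_on (loss A) (feasible I J) (X', Y')))"
proof (intro conjI impI)
  have not_spurious: "\<not> spurious_local_min_on (loss A) (feasible I J) (X, Y)"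
    if "CEC_full_rank I J (X, Y)" for X Y
    by (rule CEC_full_rank_not_spurious[OF rect disj that])
  show "\<not> spurious_local_min_on (loss A) (feasible I J) (X, Y)" if "CEC_full_rank I J (X, Y)"
    using that by (rule not_spurious)
  obtain X' Y' where path:
    "path_component {z \<in> feasible I J. fst z \<odot> snd z = X \<odot> Y} (X, Y) (X', Y')"
    and full: "CEC_full_rank I J (X', Y')"
    using CEC_full_rank_path[OF feas] by blast
  then obtain \<gamma> where \<gamma>: "path \<gamma>" "path_image \<gamma> \<subseteq> {z \<in> feasible I J. fst z \<odot> snd z = X \<odot> Y}"
    "pathstart \<gamma> = (X, Y)" "pathfinish \<gamma> = (X', Y')"
    unfolding path_component_def by blast
  have "loss A (\<gamma> t) = loss A (X, Y)" if "t \<in> {0..1}" for t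
  proof -
    have "\<gamma> t \<in> {z \<in> feasible I J. fst z \<odot> snd z = X \<odot> Y}"
      using \<gamma>(2) that unfolding path_image_def by blast
    then have "fst (\<gamma> t) \<odot> snd (\<gamma> t) = X \<odot> Y" by simp
    then show ?thesis
      by (metis loss_eq prod.collapse)
  qed
  moreover have "(X', Y') \<in> feasible I J"
    using path_component_mem(2)[OF path] by simp
  moreover have "feasible_path I J \<gamma>"
    using \<gamma>(1,2) by (auto simp: feasible_path_def)
  moreover have "\<not> spurious_local_min_on (loss A) (feasible I J) (X', Y')"
    using full by (rule not_spurious)
  ultimately show "\<exists>\<gamma> X' Y'. feasible_path I J \<gamma> \<and>
      pathstart \<gamma> = (X, Y) \<and> pathfinish \<gamma> = (X', Y') \<and> (X', Y') \<in> feasible I J \<and>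
      (\<forall>t\<in>{0..1}. loss A (\<gamma> t) = loss A (X, Y)) \<and>
      \<not> spurious_local_min_on (loss A) (feasible I J) (X', Y')"
    using \<gamma>(3,4) by blast
qed

end
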